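(* Let $\alpha\in[0,1]$, $\delta\in(-1,\infty)$, and let $(G(t))_{t\ge 0}$ be the random graph process with parameters $\alpha,\delta$ described in the context. Let $N(\ell;t)$ be the number of vertices of degree $\ell$ in $G(t)$. Let $$A=\frac{(\alpha+1)^2+\delta\alpha}{(\alpha+1)[2(\alpha+1)+\delta]},$$ and for $\ell\ge 1$ $$A_\ell=\frac{[(\alpha+1)^2+\delta\alpha]+\delta(1+\alpha)(1-\alpha)/\ell}{(\alpha+1)[2(\alpha+1)+\delta]}.$$ Then for every integer $\ell\ge 1$ and every $\epsilon>0$, $$\lim_{t\to\infty}\mathbb{P}\left(\left|\frac{N(\ell;t)}{t}-p(\ell)\right|<\epsilon\right)=1,$$ where $$p(\ell)=\begin{cases}\dfrac{1-\alpha}{A_1+1}, & \ell=1,\\[2mm] \dfrac{A_1+\alpha}{(A_1+1)(2A_2+1)}, & \ell=2,\\[2mm] \dfrac{A_1+\alpha}{A_1\,\ell A_\ell\prod_{j=1}^{\ell}\left(1+\frac{1}{jA_j}\right)}, & \ell\ge 3.\end{cases}$$ Moreover, $p(\ell)=\Theta(\ell^{-\gamma})$ as $\ell\to\infty$, with $\gamma=1+\frac1A$.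
   Context: The model: $(G(t))_{t\in\mathbb{N}_0}$ is a random process of undirected simple graphs with vertex set $V_t=\{v_1,\dots,v_{t+2}\}$ and edge set $E_t$. $G(0)$ consists of two vertices $v_1,v_2$ joined by an edge. Given $G(0),\dots,G(t)$, the graph $G(t+1)$ is obtained from $G(t)$ by adding a new vertex $v_{t+3}$ and, with a choice between the two options made independently of the past: - with probability $1-\alpha$, joining $v_{t+3}$ by an edge to exactly one vertex of $V_t$, where $u\in V_t$ is chosen with (conditional) probability $\frac{d_t(u)+\delta}{2|E_t|+\delta(t+2)}$, $d_t(u)$ being the degree of $u$ in $G(t)$; - with probability $\alpha$, choosing an edge $\{u,v\}\in E_t$ uniformly at random and joining $v_{t+3}$ by edges to both $u$ and $v$ (so a triangle is created). Notation: $x_\ell=\Theta(y_\ell)$ means there are constants $C,c>0$ with $c\,y_\ell\le x_\ell\le C\,y_\ell$ for all large enough $\ell$. *)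

theory Defs
  imports "HOL-Probability.Probability"
begin

text \<open>A graph is a pair of a vertex set and a set of two-element edges; the vertex \<open>v\<^sub>i\<close> is the number \<open>i\<close>.\<close>

type_synonym ugraph = "nat set \<times> nat set set"

definition verts :: "ugraph \<Rightarrow> nat set" where
  "verts g = fst g"

definition edges :: "ugraph \<Rightarrow> nat set set" where
  "edges g = snd g"

definition deg :: "ugraph \<Rightarrow> nat \<Rightarrow> nat" where
  "deg g u = card {e \<in> edges g. u \<in> e}"

definition initial_graph :: ugraph where
  "initial_graph = ({1, 2}, {{1, 2}})"

definition join_new :: "nat \<Rightarrow> nat set \<Rightarrow> ugraph \<Rightarrow> ugraph" where
  "join_new w S g = (insert w (verts g), edges g \<union> {{u, w} | u. u \<in> S})"

text \<open>\<^const>\<open>embed_pmf\<close> is meaningful only for nonnegative weights of total mass 1; see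
  \<open>pmf_preferential_vertex\<close> below.\<close>

definition preferential_vertex :: "real \<Rightarrow> nat \<Rightarrow> ugraph \<Rightarrow> nat pmf" where
  "preferential_vertex \<delta> t g = embed_pmf (\<lambda>u. if u \<in> verts g
     then (real (deg g u) + \<delta>) / (2 * real (card (edges g)) + \<delta> * (real t + 2)) else 0)"

text \<open>Conditional law of \<open>G(t+1)\<close> when \<open>G(t) = g\<close>; the coin shows \<open>True\<close> (a triangle is created)
  with probability \<open>\<alpha>\<close>.\<close>

definition graph_step :: "real \<Rightarrow> real \<Rightarrow> nat \<Rightarrow> ugraph \<Rightarrow> ugraph pmf" where
  "graph_step \<alpha> \<delta> t g =
     bind_pmf (bernoulli_pmf \<alpha>) (\<lambda>triangle.
       if triangle
       then map_pmf (\<lambda>e. join_new (t + 3) e g) (pmf_of_set (edges g))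
       else map_pmf (\<lambda>u. join_new (t + 3) {u} g) (preferential_vertex \<delta> t g))"

text \<open>The conditioning is on the whole history \<open>G(0), \<dots>, G(t)\<close>, so that the new random choices
  are independent of the past.\<close>

definition random_graph_process ::
    "real \<Rightarrow> real \<Rightarrow> 'w measure \<Rightarrow> (nat \<Rightarrow> 'w \<Rightarrow> ugraph) \<Rightarrow> bool" where
  "random_graph_process \<alpha> \<delta> M G \<longleftrightarrow>
     prob_space M \<and>
     (\<forall>t. G t \<in> measurable M (count_space UNIV)) \<and>
     (AE \<omega> in M. G 0 \<omega> = initial_graph) \<and>
     (\<forall>t g h. \<P>(\<omega> in M. \<forall>s\<le>t. G s \<omega> = g s) > 0 \<longrightarrow>
        \<P>(\<omega> in M. G (Suc t) \<omega> = h \<bar> \<forall>s\<le>t. G s \<omega> = g s) = pmf (graph_step \<alpha> \<delta> t (g t)) h)"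

definition num_deg :: "nat \<Rightarrow> ugraph \<Rightarrow> nat" where
  "num_deg l g = card {u \<in> verts g. deg g u = l}"

definition A_lim :: "real \<Rightarrow> real \<Rightarrow> real" where
  "A_lim \<alpha> \<delta> = ((\<alpha> + 1)\<^sup>2 + \<delta> * \<alpha>) / ((\<alpha> + 1) * (2 * (\<alpha> + 1) + \<delta>))"

definition A_seq :: "real \<Rightarrow> real \<Rightarrow> nat \<Rightarrow> real" where
  "A_seq \<alpha> \<delta> l = (((\<alpha> + 1)\<^sup>2 + \<delta> * \<alpha>) + \<delta> * (1 + \<alpha>) * (1 - \<alpha>) / real l)
     / ((\<alpha> + 1) * (2 * (\<alpha> + 1) + \<delta>))"

text \<open>Only the values at \<open>l \<ge> 1\<close> are used.\<close>

definition p_lim :: "real \<Rightarrow> real \<Rightarrow> nat \<Rightarrow> real" where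
  "p_lim \<alpha> \<delta> l =
     (if l = 1 then (1 - \<alpha>) / (A_seq \<alpha> \<delta> 1 + 1)
      else if l = 2 then (A_seq \<alpha> \<delta> 1 + \<alpha>) / ((A_seq \<alpha> \<delta> 1 + 1) * (2 * A_seq \<alpha> \<delta> 2 + 1))
      else (A_seq \<alpha> \<delta> 1 + \<alpha>) /
        (A_seq \<alpha> \<delta> 1 * (real l * A_seq \<alpha> \<delta> l) * (\<Prod>j=1..l. 1 + 1 / (real j * A_seq \<alpha> \<delta> j))))"

text \<open>The weights in \<open>preferential_vertex\<close> form a probability distribution on every graph with
  \<open>t + 2\<close> vertices and no isolated vertex, in particular on every graph the process can reach.\<close>

lemma pmf_preferential_vertex:
  assumes V: "finite (verts g)" "card (verts g) = t + 2"
    and E: "\<And>e. e \<in> edges g \<Longrightarrow> e \<subseteq> verts g \<and> card e = 2"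
    and D: "\<And>u. u \<in> verts g \<Longrightarrow> deg g u \<ge> 1"
    and \<delta>: "\<delta> > -1"
  shows "pmf (preferential_vertex \<delta> t g) u = (if u \<in> verts g
     then (real (deg g u) + \<delta>) / (2 * real (card (edges g)) + \<delta> * (real t + 2)) else 0)"
proof -
  define S where "S = 2 * real (card (edges g)) + \<delta> * (real t + 2)"
  define f where "f = (\<lambda>u. if u \<in> verts g then (real (deg g u) + \<delta>) / S else 0)"
  have finE: "finite (edges g)"
    using E V(1) by (meson Pow_iff finite_Pow_iff rev_finite_subset subsetI)
  have "(\<Sum>u\<in>verts g. deg g u) = (\<Sum>e\<in>edges g. card {u \<in> verts g. u \<in> e})"
    unfolding deg_def using V(1) finE by (rule sum_multicount_gen) simp
  also have "\<dots> = (\<Sum>e\<in>edges g. 2)"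
  proof (rule sum.cong)
    fix e assume "e \<in> edges g"
    then have "{u \<in> verts g. u \<in> e} = e" "card e = 2" using E by blast+
    then show "card {u \<in> verts g. u \<in> e} = 2" by simp
  qed simp
  finally have "(\<Sum>u\<in>verts g. real (deg g u)) = 2 * real (card (edges g))"
    by (simp flip: of_nat_sum)
  then have sumS: "(\<Sum>u\<in>verts g. real (deg g u) + \<delta>) = S"
    by (simp add: sum.distrib V(2) S_def algebra_simps)
  have pos: "real (deg g u) + \<delta> > 0" if "u \<in> verts g" for u
    using D[OF that] \<delta> by linarith
  have ne: "verts g \<noteq> {}" using V by auto
  have S: "S > 0"
    unfolding sumS[symmetric] by (rule sum_pos) (use V(1) ne pos in auto)
  have nonneg: "0 \<le> f u" for u
    using pos S by (auto simp: f_def intro!: divide_nonneg_pos less_imp_le)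
  have "(\<integral>\<^sup>+u. ennreal (f u) \<partial>count_space UNIV) = (\<integral>\<^sup>+u. ennreal (f u) \<partial>count_space (verts g))"
    by (rule nn_integral_count_space_eq) (auto simp: f_def)
  also have "\<dots> = ennreal (\<Sum>u\<in>verts g. f u)"
    using V(1) nonneg by (simp add: nn_integral_count_space_finite)
  also have "(\<Sum>u\<in>verts g. f u) = 1"
    using S sumS by (simp add: f_def flip: sum_divide_distrib)
  finally have "pmf (embed_pmf f) u = f u"
    using nonneg by (intro pmf_embed_pmf) auto
  then show ?thesis
    unfolding preferential_vertex_def f_def S_def .
qed

end

theory Submission
  imports Defs "HOL-Real_Asymp.Real_Asymp"
begin

text \<open>The graph at time \<open>t\<close> has \<open>n = t + 2\<close> vertices and about \<open>(1 + \<alpha>) n\<close> edges, because a step adds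
one or two edges, \<open>1 + \<alpha>\<close> on average. A given vertex of degree \<open>l\<close> therefore receives an edge in
the next step with probability about \<open>a\<^sub>l / n\<close>, where \<open>a\<^sub>l = l A\<^sub>l\<close>: preferential choice contributes
\<open>(1 - \<alpha>) (l + \<delta>) / (2 (1 + \<alpha>) + \<delta>)\<close> and the uniform edge contributes \<open>\<alpha> l / (1 + \<alpha>)\<close>. The number
\<open>N\<^sub>l\<close> of vertices of degree \<open>l\<close> thus changes on average by about
\<open>(a\<^bsub>l-1\<^esub> N\<^bsub>l-1\<^esub> - a\<^sub>l N\<^sub>l) / n\<close>, plus \<open>1 - \<alpha>\<close> if \<open>l = 1\<close> and \<open>\<alpha>\<close> if \<open>l = 2\<close> for the new vertex.
The limiting frequencies have to reproduce themselves under this flow, and \<open>p_lim\<close> solves that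
equation (\<open>p_lim_balance\<close>).

Convergence in probability follows from a second-moment argument. The deviation
\<open>X = N\<^sub>l - p(l) n\<close> changes by a bounded amount in each step, and its drift is \<open>- a\<^sub>l X / n\<close> up to
terms bounded by \<open>\<bar>N\<^bsub>l-1\<^esub> - p(l-1) n\<bar> / n\<close> and by the deviation of the edge count over \<open>n\<close>
(\<open>drift_linearization\<close>). The main term has the sign opposite to \<open>X\<close>, so it only decreases
\<open>X\<^sup>2\<close> to first order. If the remaining terms vanish in mean, then the mean of \<open>X\<^sup>2\<close> grows by
\<open>o(n)\<close> per step; so it is \<open>o(n\<^sup>2)\<close>, and the mean of \<open>\<bar>X\<bar>\<close> is \<open>o(n)\<close>
(\<open>mean_negligible_if_small_drift\<close>). This applies to the edge count, whose drift is exactly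
\<open>1 + \<alpha>\<close>, and then to each degree by induction on \<open>l\<close>. Markov's inequality finishes this part. Only
the law of the graph at each single time matters, and that law is the one of the Markov chain with
the given transition probabilities (\<open>prob_eq_chain_law\<close>).

For the tail, \<open>a\<^sub>l\<close> is an affine function of \<open>l\<close> with slope \<open>A\<close>. The product in the formula
for \<open>p_lim\<close> is then a quotient of two Pochhammer symbols whose arguments differ by \<open>1 / A\<close>, so it
grows like \<open>l powr (1 / A)\<close>; the factor \<open>a\<^sub>l\<close> accounts for the remaining power of \<open>l\<close>.\<close>

section \<open>One-dimensional laws of a process with given transition probabilities\<close>

primrec chain_law :: "'b \<Rightarrow> (nat \<Rightarrow> 'b \<Rightarrow> 'b pmf) \<Rightarrow> nat \<Rightarrow> 'b pmf" where
  "chain_law x0 K 0 = return_pmf x0"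
| "chain_law x0 K (Suc t) = bind_pmf (chain_law x0 K t) (K t)"

primrec history :: "(nat \<Rightarrow> 'a \<Rightarrow> 'b) \<Rightarrow> nat \<Rightarrow> 'a \<Rightarrow> 'b list" where
  "history G 0 \<omega> = [G 0 \<omega>]"
| "history G (Suc t) \<omega> = G (Suc t) \<omega> # history G t \<omega>"

primrec history_law :: "'b \<Rightarrow> (nat \<Rightarrow> 'b \<Rightarrow> 'b pmf) \<Rightarrow> nat \<Rightarrow> 'b list pmf" where
  "history_law x0 K 0 = return_pmf [x0]"
| "history_law x0 K (Suc t) =
     bind_pmf (history_law x0 K t) (\<lambda>xs. map_pmf (\<lambda>x. x # xs) (K t (hd xs)))"

lemma hd_history [simp]: "hd (history G t \<omega>) = G t \<omega>"
  by (cases t) auto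

lemma history_eq_iff: "history G t \<omega> = history G t \<omega>' \<longleftrightarrow> (\<forall>s\<le>t. G s \<omega> = G s \<omega>')"
  by (induction t) (auto simp: le_Suc_eq)

lemma map_pmf_hd_history_law: "map_pmf hd (history_law x0 K t) = chain_law x0 K t"
proof (induction t)
  case (Suc t)
  have "map_pmf hd (history_law x0 K (Suc t)) = bind_pmf (history_law x0 K t) (\<lambda>xs. K t (hd xs))"
    by (simp add: map_bind_pmf pmf.map_comp o_def)
  also have "\<dots> = bind_pmf (map_pmf hd (history_law x0 K t)) (K t)"
    by (simp add: bind_map_pmf)
  finally show ?case by (simp add: Suc)
qed simp

text \<open>A list of states determines its last step, so no two histories contribute to the same longer history.\<close>

lemma pmf_history_law_Cons:
  "pmf (history_law x0 K (Suc t)) (x # xs) = pmf (history_law x0 K t) xs * pmf (K t (hd xs)) x"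
proof -
  have "pmf (map_pmf (\<lambda>y. y # ys) (K t (hd ys))) (x # xs) =
      indicator {xs} ys * pmf (K t (hd xs)) x" for ys
  proof -
    have "(\<lambda>y. y # ys) -` {x # xs} = (if ys = xs then {x} else {})" by auto
    then show ?thesis by (simp add: pmf_map measure_pmf_single)
  qed
  then show ?thesis
    by (simp add: pmf_bind measure_pmf_single)
qed

context prob_space
begin

lemma sets_history_event:
  assumes meas: "\<And>t. G t \<in> measurable M (count_space UNIV)"
  shows "{\<omega> \<in> space M. history G t \<omega> = xs} \<in> sets M"
proof (induction t arbitrary: xs)
  case 0
  have [measurable]: "G 0 \<in> measurable M (count_space UNIV)" by (rule meas)
  have eq: "{\<omega> \<in> space M. history G 0 \<omega> = xs} = (if length xs = 1 then {\<omega> \<in> space M. G 0 \<omega> = hd xs} else {})"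
    by (cases xs) auto
  show ?case unfolding eq by auto
next
  case (Suc t)
  have [measurable]: "G (Suc t) \<in> measurable M (count_space UNIV)" by (rule meas)
  have eq: "{\<omega> \<in> space M. history G (Suc t) \<omega> = xs} = (if xs = [] then {} else
      {\<omega> \<in> space M. G (Suc t) \<omega> = hd xs} \<inter> {\<omega> \<in> space M. history G t \<omega> = tl xs})"
    by (cases xs) auto
  show ?case unfolding eq using Suc by auto
qed

text \<open>The hypothesis \<open>cond\<close> determines the probability of a history only after division by the
probability of the past, so pasts of probability zero need a separate argument: every continuation
of such a past has probability zero under both laws.\<close>

lemma prob_history:
  assumes meas: "\<And>t. G t \<in> measurable M (count_space UNIV)"
    and init: "AE \<omega> in M. G 0 \<omega> = x0"
    and cond: "\<And>t g h. \<P>(\<omega> in M. \<forall>s\<le>t. G s \<omega> = g s) > 0 \<Longrightarrow>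
        \<P>(\<omega> in M. G (Suc t) \<omega> = h \<bar> \<forall>s\<le>t. G s \<omega> = g s) = pmf (K t (g t)) h"
  shows "\<P>(\<omega> in M. history G t \<omega> = xs) = pmf (history_law x0 K t) xs"
proof (induction t arbitrary: xs)
  case 0
  have "\<P>(\<omega> in M. history G 0 \<omega> = xs) = \<P>(\<omega> in M. [x0] = xs)"
    using init sets_history_event[where t = 0 and xs = xs, OF meas] by (intro prob_eq_AE) auto
  also have "\<dots> = pmf (history_law x0 K 0) xs"
    by (simp add: pmf_return indicator_def prob_space)
  finally show ?case .
next
  case (Suc t)
  show ?case
  proof (cases xs)
    case Nil
    have "[] \<notin> set_pmf (history_law x0 K (Suc t))" by auto
    then have "pmf (history_law x0 K (Suc t)) [] = 0"
      by (metis pmf_eq_0_set_pmf)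
    then show ?thesis by (simp add: Nil del: history_law.simps)
  next
    case (Cons y ys)
    let ?past = "{\<omega> \<in> space M. history G t \<omega> = ys}"
    have split: "{\<omega> \<in> space M. history G (Suc t) \<omega> = xs} = {\<omega> \<in> space M. G (Suc t) \<omega> = y \<and> history G t \<omega> = ys}"
      using Cons by auto
    show ?thesis
    proof (cases "prob ?past = 0")
      case True
      have "prob {\<omega> \<in> space M. history G (Suc t) \<omega> = xs} \<le> prob ?past"
        using sets_history_event[OF meas] by (intro finite_measure_mono) (auto simp: Cons)
      then show ?thesis using True Suc[of ys] Cons pmf_history_law_Cons[of x0 K t y ys] by (simp add: measure_le_0_iff)
    next
      case False
      then have "?past \<noteq> {}" by (metis measure_empty)
      \<comment> \<open>A realized past supplies the state sequence on which to condition.\<close>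
      then obtain \<omega>0 where \<omega>0: "history G t \<omega>0 = ys" by auto
      define g where "g = (\<lambda>s. G s \<omega>0)"
      have past: "history G t \<omega> = ys \<longleftrightarrow> (\<forall>s\<le>t. G s \<omega> = g s)" for \<omega>
        unfolding \<omega>0[symmetric] history_eq_iff g_def ..
      have "g t = hd ys" unfolding g_def \<omega>0[symmetric] by simp
      moreover have "\<P>(\<omega> in M. \<forall>s\<le>t. G s \<omega> = g s) > 0"
        using False unfolding past by (simp add: zero_less_measure_iff)
      ultimately have "\<P>(\<omega> in M. G (Suc t) \<omega> = y \<bar> history G t \<omega> = ys) = pmf (K t (hd ys)) y"
        using cond[of t g y] unfolding past by simp
      then have "prob {\<omega> \<in> space M. G (Suc t) \<omega> = y \<and> history G t \<omega> = ys} =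
          prob ?past * pmf (K t (hd ys)) y"
        using False by (auto simp: cond_prob_def field_simps)
      then show ?thesis
        unfolding split Cons pmf_history_law_Cons using Suc by simp
    qed
  qed
qed

text \<open>The state space may be uncountable, but the law of the history lives on a countable set. Summing
over the histories in that set shows only that \<open>G t\<close> hits \<open>S\<close> at least as often as the chain does;
the same inequality for the complement of \<open>S\<close> turns this into an equality.\<close>

lemma prob_eq_chain_law:
  assumes meas: "\<And>t. G t \<in> measurable M (count_space UNIV)"
    and init: "AE \<omega> in M. G 0 \<omega> = x0"
    and cond: "\<And>t g h. \<P>(\<omega> in M. \<forall>s\<le>t. G s \<omega> = g s) > 0 \<Longrightarrow>
        \<P>(\<omega> in M. G (Suc t) \<omega> = h \<bar> \<forall>s\<le>t. G s \<omega> = g s) = pmf (K t (g t)) h"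
  shows "\<P>(\<omega> in M. G t \<omega> \<in> S) = measure_pmf.prob (chain_law x0 K t) S"
proof -
  define L where "L = history_law x0 K t"
  have ev [measurable]: "{\<omega> \<in> space M. G t \<omega> \<in> S} \<in> sets M" for S
    using measurable_sets[OF meas[of t], of S] by (simp add: vimage_def Collect_conj_eq Int_commute)
  have ge: "measure_pmf.prob (chain_law x0 K t) S \<le> \<P>(\<omega> in M. G t \<omega> \<in> S)" for S
  proof -
    define I where "I = {xs. hd xs \<in> S} \<inter> set_pmf L"
    define X where "X xs = {\<omega> \<in> space M. history G t \<omega> = xs}" for xs
    have X: "X xs \<in> sets M" for xs unfolding X_def by (rule sets_history_event[OF meas])
    have "ennreal (measure_pmf.prob (chain_law x0 K t) S) = emeasure L {xs. hd xs \<in> S}"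
      unfolding L_def map_pmf_hd_history_law[symmetric]
      by (simp add: measure_pmf.emeasure_eq_measure vimage_def)
    also have "\<dots> = emeasure L I"
      unfolding I_def by (simp add: emeasure_Int_set_pmf)
    also have "\<dots> = (\<integral>\<^sup>+xs. pmf L xs \<partial>count_space I)"
      by (rule nn_integral_pmf[symmetric])
    also have "\<dots> = (\<integral>\<^sup>+xs. emeasure M (X xs) \<partial>count_space I)"
      using prob_history[OF meas init cond] by (simp add: L_def X_def emeasure_eq_measure)
    also have "\<dots> = emeasure M (\<Union>(X ` I))"
    proof (rule emeasure_UN_countable[symmetric])
      show "disjoint_family_on X I" by (auto simp: X_def disjoint_family_on_def)
    qed (auto simp: I_def intro: X)
    also have "\<dots> \<le> emeasure M {\<omega> \<in> space M. G t \<omega> \<in> S}"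
      by (rule emeasure_mono) (auto simp: X_def I_def)
    finally show ?thesis by (simp add: emeasure_eq_measure)
  qed
  have "\<P>(\<omega> in M. G t \<omega> \<in> - S) = 1 - \<P>(\<omega> in M. G t \<omega> \<in> S)"
    using prob_compl[OF ev[of S]] by (simp add: set_diff_eq Collect_conj_eq[symmetric])
     (metis (mono_tags, lifting) Collect_cong)
  moreover have "measure_pmf.prob (chain_law x0 K t) (- S) = 1 - measure_pmf.prob (chain_law x0 K t) S"
    using measure_pmf.prob_compl[of S "chain_law x0 K t"] by (simp add: Compl_eq_Diff_UNIV)
  ultimately show ?thesis using ge[of S] ge[of "- S"] by linarith
qed

end

section \<open>Negligible deviations from small drift\<close>

text \<open>From some time on the increments are at most \<open>e / 2 * (t + 2)\<close>, which is less than the increment of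
\<open>e / 2 * (t + 2)\<^sup>2\<close>; what was accumulated before is a constant.\<close>

lemma square_growth_negligible:
  fixes y r :: "nat \<Rightarrow> real"
  assumes nonneg: "\<And>t. 0 \<le> y t"
    and step: "\<And>t. y (Suc t) \<le> y t + real (t + 2) * r t"
    and r: "r \<longlonglongrightarrow> 0"
  shows "(\<lambda>t. y t / (real (t + 2))\<^sup>2) \<longlonglongrightarrow> 0"
proof (rule LIMSEQ_I)
  fix e :: real assume e: "0 < e"
  obtain T where T: "\<And>t. t \<ge> T \<Longrightarrow> r t < e / 2"
    using order_tendstoD(2)[OF r, of "e/2"] e by (auto simp: eventually_sequentially)
  have bound: "y t \<le> y T + e / 2 * (real (t + 2))\<^sup>2" if "t \<ge> T" for t
    using that
  proof (induction t rule: dec_induct)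
    case base
    show ?case using e by simp
  next
    case (step t)
    have "real (t + 2) * r t \<le> real (t + 2) * (e / 2)"
      using T[of t] step.hyps by (intro mult_left_mono) auto
    also have "\<dots> \<le> e / 2 * (real (Suc t + 2))\<^sup>2 - e / 2 * (real (t + 2))\<^sup>2"
    proof -
      have "real (t + 2) * (e / 2) \<le> e / 2 * (2 * real t + 5)"
        using e by (subst mult.commute, intro mult_left_mono) auto
      then show ?thesis by (simp add: power2_eq_square algebra_simps)
    qed
    finally show ?case using step.IH assms(2)[of t] by linarith
  qed
  have lim: "(\<lambda>t. y T / (real (t + 2))\<^sup>2) \<longlonglongrightarrow> 0"
    by real_asymp
  have "0 < e / 2" using e by simp
  from order_tendstoD(2)[OF lim this]
  obtain T' where T': "\<And>t. t \<ge> T' \<Longrightarrow> y T / (real (t + 2))\<^sup>2 < e / 2"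
    unfolding eventually_sequentially by blast
  have "norm (y t / (real (t + 2))\<^sup>2 - 0) < e" if "t \<ge> max T T'" for t
  proof -
    have "y t / (real (t + 2))\<^sup>2 \<le> (y T + e / 2 * (real (t + 2))\<^sup>2) / (real (t + 2))\<^sup>2"
      using bound[of t] that by (intro divide_right_mono) auto
    also have "\<dots> = y T / (real (t + 2))\<^sup>2 + e / 2"
      by (simp add: add_divide_distrib)
    also have "\<dots> < e"
    proof -
      have "y T / (real (t + 2))\<^sup>2 < e / 2" by (rule T') (use that in simp)
      then show ?thesis by linarith
    qed
    finally show ?thesis using nonneg[of t] by simp
  qed
  then show "\<exists>N. \<forall>t\<ge>N. norm (y t / (real (t + 2))\<^sup>2 - 0) < e" by blast
qed

text \<open>Expanding \<open>(X + \<Delta>X)\<^sup>2\<close> shows that one step raises the mean of \<open>X\<^sup>2\<close> by at most twice the mean of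
\<open>\<bar>X\<bar> R\<close> plus \<open>C\<^sup>2\<close>. As \<open>X\<close> is at most linear in time, this is \<open>o(t)\<close>. The hypothesis
\<open>drift\<close> bounds the product of \<open>X\<close> with its drift from above only: a drift towards zero, however
large, is harmless. The linear scale is written \<open>t + 2\<close>, the number of vertices in the
application.\<close>

lemma mean_negligible_if_small_drift:
  fixes X R :: "nat \<Rightarrow> 'a \<Rightarrow> real" and x0 :: 'a and K :: "nat \<Rightarrow> 'a \<Rightarrow> 'a pmf"
  defines "p \<equiv> chain_law x0 K"
  assumes fin: "\<And>t. finite (set_pmf (p t))"
    and growth: "\<And>t g. g \<in> set_pmf (p t) \<Longrightarrow> \<bar>X t g\<bar> \<le> B * real (t + 2)"
    and incr: "\<And>t g h. g \<in> set_pmf (p t) \<Longrightarrow> h \<in> set_pmf (K t g) \<Longrightarrow> \<bar>X (Suc t) h - X t g\<bar> \<le> C"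
    and drift: "\<And>t g. g \<in> set_pmf (p t) \<Longrightarrow>
        X t g * (measure_pmf.expectation (K t g) (X (Suc t)) - X t g) \<le> \<bar>X t g\<bar> * R t g"
    and R_nonneg: "\<And>t g. g \<in> set_pmf (p t) \<Longrightarrow> 0 \<le> R t g"
    and R: "(\<lambda>t. measure_pmf.expectation (p t) (R t)) \<longlonglongrightarrow> 0"
  shows "(\<lambda>t. measure_pmf.expectation (p t) (\<lambda>g. \<bar>X t g\<bar>) / real (t + 2)) \<longlonglongrightarrow> 0"
proof -
  define y where "y t = measure_pmf.expectation (p t) (\<lambda>g. (X t g)\<^sup>2)" for t
  define ER where "ER t = measure_pmf.expectation (p t) (R t)" for t
  have int: "integrable (measure_pmf (p t)) f" for t and f :: "'a \<Rightarrow> real"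
    by (rule integrable_measure_pmf_finite[OF fin])
  have finK: "finite (set_pmf (K t g))" if "g \<in> set_pmf (p t)" for t g
    by (rule finite_subset[OF _ fin[of "Suc t"]]) (use that in \<open>auto simp: p_def\<close>)
  have one_step: "measure_pmf.expectation (K t g) (\<lambda>h. (X (Suc t) h)\<^sup>2) \<le>
      (X t g)\<^sup>2 + 2 * B * real (t + 2) * R t g + C\<^sup>2" if g: "g \<in> set_pmf (p t)" for t g
  proof -
    have intK: "integrable (measure_pmf (K t g)) f" for f :: "'a \<Rightarrow> real"
      by (rule integrable_measure_pmf_finite[OF finK[OF g]])
    let ?x = "X t g" and ?E = "measure_pmf.expectation (K t g)"
    have "?E (\<lambda>h. (X (Suc t) h)\<^sup>2) = ?E (\<lambda>h. ?x\<^sup>2 + 2 * ?x * (X (Suc t) h - ?x) + (X (Suc t) h - ?x)\<^sup>2)"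
      by (rule Bochner_Integration.integral_cong) (auto simp: power2_eq_square algebra_simps)
    also have "\<dots> = ?x\<^sup>2 + 2 * (?x * (?E (X (Suc t)) - ?x)) + ?E (\<lambda>h. (X (Suc t) h - ?x)\<^sup>2)"
      by (simp add: intK)
    also have "?E (\<lambda>h. (X (Suc t) h - ?x)\<^sup>2) \<le> ?E (\<lambda>_. C\<^sup>2)"
      using incr[OF g] by (intro integral_mono_AE intK AE_pmfI) (metis abs_ge_zero power2_abs power_mono)
    also have "?x * (?E (X (Suc t)) - ?x) \<le> (B * real (t + 2)) * R t g"
      using drift[OF g] mult_right_mono[OF growth[OF g] R_nonneg[OF g]] by linarith
    finally show ?thesis by simp
  qed
  have y_step: "y (Suc t) \<le> y t + real (t + 2) * (2 * B * ER t + C\<^sup>2 / real (t + 2))" for t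
  proof -
    have "y (Suc t) = measure_pmf.expectation (p t)
        (\<lambda>g. measure_pmf.expectation (K t g) (\<lambda>h. (X (Suc t) h)\<^sup>2))"
      unfolding y_def p_def chain_law.simps
      using fin[of t] finK[of _ t]
      by (subst pmf_expectation_bind[where A = "set_pmf (p t)"])
         (auto simp: p_def integral_measure_pmf[of "set_pmf (chain_law x0 K t)"])
    also have "\<dots> \<le> measure_pmf.expectation (p t)
        (\<lambda>g. (X t g)\<^sup>2 + 2 * B * real (t + 2) * R t g + C\<^sup>2)"
      using one_step by (intro integral_mono_AE int AE_pmfI)
    also have "\<dots> = y t + 2 * B * real (t + 2) * ER t + C\<^sup>2"
      by (simp add: int y_def ER_def)
    also have "\<dots> = y t + real (t + 2) * (2 * B * ER t + C\<^sup>2 / real (t + 2))"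
      by (simp add: field_simps)
    finally show ?thesis .
  qed
  have "(\<lambda>t. C\<^sup>2 / real (t + 2)) \<longlonglongrightarrow> 0" by real_asymp
  then have "(\<lambda>t. 2 * B * ER t + C\<^sup>2 / real (t + 2)) \<longlonglongrightarrow> 0"
    using tendsto_add[OF tendsto_mult_left[OF R[folded ER_def], of "2 * B"]] by fastforce
  then have sq: "(\<lambda>t. y t / (real (t + 2))\<^sup>2) \<longlonglongrightarrow> 0"
    using y_step by (intro square_growth_negligible) (auto simp: y_def)
  have "norm (measure_pmf.expectation (p t) (\<lambda>g. \<bar>X t g\<bar>) / real (t + 2)) \<le> sqrt (y t / (real (t + 2))\<^sup>2)" for t
  proof -
    \<comment> \<open>The square of the mean is at most the mean of the square, since the variance is nonnegative.\<close>
    have "(measure_pmf.expectation (p t) (\<lambda>g. \<bar>X t g\<bar>))\<^sup>2 \<le> y t"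
      using measure_pmf.variance_positive[of "p t" "\<lambda>g. \<bar>X t g\<bar>"]
      by (subst (asm) measure_pmf.variance_eq) (auto simp: int y_def)
    then have "\<bar>measure_pmf.expectation (p t) (\<lambda>g. \<bar>X t g\<bar>)\<bar> \<le> sqrt (y t)"
      by (intro real_le_rsqrt) simp
    then show ?thesis
      by (simp add: real_sqrt_divide divide_right_mono)
  qed
  then have "\<forall>\<^sub>F t in sequentially. norm (measure_pmf.expectation (p t) (\<lambda>g. \<bar>X t g\<bar>) / real (t + 2)) \<le>
      sqrt (y t / (real (t + 2))\<^sup>2)"
    by (intro always_eventually) simp
  moreover have "(\<lambda>t. sqrt (y t / (real (t + 2))\<^sup>2)) \<longlonglongrightarrow> 0"
    using tendsto_real_sqrt[OF sq] by (simp only: real_sqrt_zero)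
  ultimately show ?thesis by (rule Lim_null_comparison)
qed

section \<open>One attachment step\<close>

text \<open>An invariant of the process. The lower bounds on degrees and on the number of edges keep the
attachment weights positive and of the order of the number of vertices; the upper bound on the
number of edges gives its linear growth.\<close>

definition attachment_graph :: "nat \<Rightarrow> ugraph \<Rightarrow> bool" where
  "attachment_graph t g \<longleftrightarrow> verts g = {1..t + 2} \<and> (\<forall>e\<in>edges g. e \<subseteq> verts g \<and> card e = 2) \<and>
     (\<forall>u\<in>verts g. 1 \<le> deg g u) \<and> t + 1 \<le> card (edges g) \<and> card (edges g) \<le> 2 * t + 1"

lemma attachment_graphD:
  assumes "attachment_graph t g"
  shows "verts g = {1..t + 2}" "finite (verts g)" "finite (edges g)" "edges g \<noteq> {}"
    "\<And>e. e \<in> edges g \<Longrightarrow> e \<subseteq> verts g" "\<And>e. e \<in> edges g \<Longrightarrow> card e = 2"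
    "\<And>u. u \<in> verts g \<Longrightarrow> 1 \<le> deg g u" "t + 1 \<le> card (edges g)" "card (edges g) \<le> 2 * t + 1"
proof -
  show "verts g = {1..t + 2}" "finite (verts g)"
    "\<And>e. e \<in> edges g \<Longrightarrow> e \<subseteq> verts g" "\<And>e. e \<in> edges g \<Longrightarrow> card e = 2"
    "\<And>u. u \<in> verts g \<Longrightarrow> 1 \<le> deg g u" "t + 1 \<le> card (edges g)" "card (edges g) \<le> 2 * t + 1"
    using assms by (auto simp: attachment_graph_def)
  from \<open>t + 1 \<le> card (edges g)\<close> have "0 < card (edges g)" by simp
  then show "finite (edges g)" "edges g \<noteq> {}"
    by (simp_all add: card_gt_0_iff)
qed

lemma attachment_graph_initial: "attachment_graph 0 initial_graph"
proof -
  have "{e. e = {1, 2} \<and> u \<in> e} = (if u \<in> {1,2} then {{1, 2 :: nat}} else {})" for u by auto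
  then have "1 \<le> deg initial_graph u" if "u \<in> {1, 2}" for u
    using that by (simp add: deg_def edges_def initial_graph_def)
  then show ?thesis
    by (auto simp: attachment_graph_def verts_def edges_def initial_graph_def)
qed

text \<open>Both kinds of step join the new vertex to a set \<open>S\<close> of one or two old vertices, the chosen vertex or
the two ends of the chosen edge.\<close>

locale attachment_step =
  fixes t :: nat and g :: ugraph and S :: "nat set"
  assumes g: "attachment_graph t g" and S: "S \<subseteq> verts g" "card S \<in> {1, 2}"
begin

lemmas graph = attachment_graphD[OF g]

lemma finite_S: "finite S"
  using graph(2) S(1) by (rule rev_finite_subset)

lemma new_vertex: "t + 3 \<notin> verts g" "t + 3 \<notin> S"
  using S(1) graph(1) by auto

lemma verts_join: "verts (join_new (t + 3) S g) = insert (t + 3) (verts g)"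
  by (simp add: verts_def join_new_def)

lemma edges_join: "edges (join_new (t + 3) S g) = edges g \<union> (\<lambda>u. {u, t + 3}) ` S"
  by (auto simp: edges_def join_new_def)

lemma old_edge: "e \<in> edges g \<Longrightarrow> t + 3 \<notin> e"
  using graph(5) new_vertex by blast

lemma inj_new_edges: "inj_on (\<lambda>u. {u, t + 3}) S"
  using new_vertex(2) by (auto simp: inj_on_def doubleton_eq_iff)

lemma card_edges_join: "card (edges (join_new (t + 3) S g)) = card (edges g) + card S"
proof -
  have "edges g \<inter> (\<lambda>u. {u, t + 3}) ` S = {}" using old_edge by auto
  then show ?thesis
    unfolding edges_join using graph(3) finite_S card_image[OF inj_new_edges]
    by (subst card_Un_disjoint) auto
qed

lemma deg_join_new: "deg (join_new (t + 3) S g) (t + 3) = card S"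
proof -
  have "{e \<in> edges (join_new (t + 3) S g). t + 3 \<in> e} = (\<lambda>u. {u, t + 3}) ` S"
    unfolding edges_join using old_edge by auto
  then show ?thesis by (simp add: deg_def card_image[OF inj_new_edges])
qed

lemma deg_join_old:
  assumes u: "u \<in> verts g"
  shows "deg (join_new (t + 3) S g) u = deg g u + of_bool (u \<in> S)"
proof -
  have "u \<noteq> t + 3" using u new_vertex by auto
  then have "{e \<in> edges (join_new (t + 3) S g). u \<in> e} =
      {e \<in> edges g. u \<in> e} \<union> (if u \<in> S then {{u, t + 3}} else {})"
    unfolding edges_join by auto
  moreover have "{u, t + 3} \<notin> edges g" using old_edge by blast
  ultimately show ?thesis
    using graph(3) by (simp add: deg_def)
qed

text \<open>Apart from the new vertex, of degree \<open>card S\<close>, only the members of \<open>S\<close> change their degree. Written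
as a sum over \<open>S\<close>, the change can be averaged over the random choice of \<open>S\<close> vertex by vertex.\<close>

lemma num_deg_join:
  "real (num_deg l (join_new (t + 3) S g)) = real (num_deg l g) + of_bool (card S = l) +
     (\<Sum>u\<in>S. of_bool (Suc (deg g u) = l) - of_bool (deg g u = l))"
proof -
  let ?h = "join_new (t + 3) S g"
  have count: "real (num_deg l k) = (\<Sum>u\<in>verts k. of_bool (deg k u = l))" if "finite (verts k)" for k
    using that by (simp add: num_deg_def Collect_conj_eq Int_commute)
  have "real (num_deg l ?h) = (\<Sum>u\<in>insert (t + 3) (verts g). of_bool (deg ?h u = l))"
    using graph(2) by (subst count) (simp_all only: verts_join finite_insert)
  also have "\<dots> = of_bool (deg ?h (t + 3) = l) + (\<Sum>u\<in>verts g. of_bool (deg ?h u = l))"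
    using graph(2) new_vertex(1) by (rule sum.insert)
  also have "(\<Sum>u\<in>verts g. of_bool (deg ?h u = l) :: real) =
      (\<Sum>u\<in>verts g. of_bool (deg g u + of_bool (u \<in> S) = l))"
    by (rule sum.cong) (simp_all add: deg_join_old)
  also have "(\<Sum>u\<in>verts g. of_bool (deg g u + of_bool (u \<in> S) = l) :: real) =
      (\<Sum>u\<in>verts g. of_bool (deg g u = l) +
         (if u \<in> S then of_bool (Suc (deg g u) = l) - of_bool (deg g u = l) else 0))"
    by (rule sum.cong) auto
  also have "\<dots> = real (num_deg l g) + (\<Sum>u\<in>S. of_bool (Suc (deg g u) = l) - of_bool (deg g u = l))"
    using graph(2) S(1) by (simp add: sum.distrib count flip: sum.inter_restrict) (simp add: Int_absorb1)
  finally show ?thesis by (simp add: deg_join_new)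
qed

lemma num_deg_join_diff: "\<bar>real (num_deg l (join_new (t + 3) S g)) - real (num_deg l g)\<bar> \<le> 3"
proof -
  have "\<bar>\<Sum>u\<in>S. of_bool (Suc (deg g u) = l) - of_bool (deg g u = l) :: real\<bar> \<le> (\<Sum>u\<in>S. 1)"
    by (rule order_trans[OF sum_abs sum_mono]) auto
  also have "\<dots> \<le> 2" using S(2) by auto
  finally show ?thesis unfolding num_deg_join by (auto simp: abs_if split: if_splits)
qed

lemma attachment_graph_join: "attachment_graph (Suc t) (join_new (t + 3) S g)"
proof -
  let ?h = "join_new (t + 3) S g"
  have "verts ?h = {1..Suc t + 2}"
    unfolding verts_join graph(1) by auto
  moreover have "e \<subseteq> verts ?h \<and> card e = 2" if "e \<in> edges ?h" for e
  proof (cases "e \<in> edges g")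
    case True
    then show ?thesis using graph(5,6) verts_join by blast
  next
    case False
    with that obtain u where u: "u \<in> S" "e = {u, t + 3}" by (auto simp: edges_join)
    then have "u \<noteq> t + 3" using new_vertex(2) by auto
    then show ?thesis using u S(1) by (auto simp: verts_join)
  qed
  moreover have "1 \<le> deg ?h u" if "u \<in> verts ?h" for u
  proof (cases "u = t + 3")
    case True
    then show ?thesis using S(2) deg_join_new by auto
  next
    case False
    then have "u \<in> verts g" using that verts_join by simp
    then show ?thesis using graph(7)[of u] deg_join_old[of u] by simp
  qed
  moreover have "Suc t + 1 \<le> card (edges ?h)" "card (edges ?h) \<le> 2 * Suc t + 1"
    using graph(8,9) S(2) by (auto simp: card_edges_join)
  ultimately show ?thesis unfolding attachment_graph_def by blast
qed

end

text \<open>Double counting of the pairs of a vertex and an edge that contains it.\<close>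

lemma sum_deg:
  fixes \<phi> :: "nat \<Rightarrow> real"
  assumes "attachment_graph t g"
  shows "(\<Sum>e\<in>edges g. \<Sum>u\<in>e. \<phi> u) = (\<Sum>u\<in>verts g. real (deg g u) * \<phi> u)"
proof -
  note graph = attachment_graphD[OF assms]
  have "(\<Sum>e\<in>edges g. \<Sum>u\<in>e. \<phi> u) = (\<Sum>e\<in>edges g. \<Sum>u | u \<in> verts g \<and> u \<in> e. \<phi> u)"
    using graph(5) by (intro sum.cong) auto
  also have "\<dots> = (\<Sum>u\<in>verts g. \<Sum>e | e \<in> edges g \<and> u \<in> e. \<phi> u)"
    by (rule sum.swap_restrict[OF graph(3) graph(2)])
  finally show ?thesis by (simp add: deg_def)
qed

text \<open>The sum over vertices of the attachment weight times the change in the count of degree \<open>Suc k\<close> that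
one more edge at this vertex would cause. With \<open>c = \<delta>\<close> the weight is that of the preferential
choice; with \<open>c = 0\<close> it is the number of edges at the vertex, as for a uniform edge.\<close>

lemma sum_deg_transitions:
  fixes c :: real
  assumes "finite (verts g)"
  shows "(\<Sum>u\<in>verts g. (real (deg g u) + c) * (of_bool (Suc (deg g u) = Suc k) - of_bool (deg g u = Suc k))) =
    (real k + c) * num_deg k g - (real (Suc k) + c) * num_deg (Suc k) g"
proof -
  have *: "(\<Sum>u\<in>verts g. (real (deg g u) + c) * of_bool (deg g u = l)) = (real l + c) * num_deg l g" for l
  proof -
    have "(\<Sum>u\<in>verts g. (real (deg g u) + c) * of_bool (deg g u = l)) =
        (\<Sum>u\<in>verts g. if deg g u = l then real l + c else 0)"
      by (rule sum.cong) auto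
    also have "\<dots> = (\<Sum>u | u \<in> verts g \<and> deg g u = l. real l + c)"
      using assms by (rule sum.inter_filter[symmetric])
    finally show ?thesis by (simp add: num_deg_def)
  qed
  show ?thesis by (simp only: right_diff_distrib sum_subtractf nat.inject *)
qed

context
  fixes \<alpha> \<delta> :: real and t :: nat and g :: ugraph
  assumes \<alpha>: "0 \<le> \<alpha>" "\<alpha> \<le> 1" and \<delta>: "-1 < \<delta>" and g: "attachment_graph t g"
begin

lemmas graph = attachment_graphD[OF g]

abbreviation (input) weight_sum where
  "weight_sum \<equiv> 2 * real (card (edges g)) + \<delta> * (real t + 2)"

lemma pmf_preferential_vertex_attachment_graph:
  "pmf (preferential_vertex \<delta> t g) u =
     (if u \<in> verts g then (real (deg g u) + \<delta>) / weight_sum else 0)"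
  using graph by (intro pmf_preferential_vertex \<delta>) auto

lemma set_preferential_vertex: "set_pmf (preferential_vertex \<delta> t g) \<subseteq> verts g"
  by (auto simp: set_pmf_iff pmf_preferential_vertex_attachment_graph split: if_splits)

lemma attachment_step_vertex: "u \<in> verts g \<Longrightarrow> attachment_step t g {u}"
  using g by unfold_locales auto

lemma attachment_step_edge: "e \<in> edges g \<Longrightarrow> attachment_step t g e"
  using g graph(5,6) by unfold_locales auto

lemma set_graph_step:
  assumes "h \<in> set_pmf (graph_step \<alpha> \<delta> t g)"
  obtains S where "attachment_step t g S" "h = join_new (t + 3) S g"
proof -
  have "(\<exists>e\<in>edges g. h = join_new (t + 3) e g) \<or> (\<exists>u\<in>verts g. h = join_new (t + 3) {u} g)"
    using assms set_preferential_vertex graph(3,4) by (auto simp: graph_step_def split: if_splits)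
  then show ?thesis using that attachment_step_vertex attachment_step_edge by blast
qed

lemma finite_graph_step: "finite (set_pmf (graph_step \<alpha> \<delta> t g))"
proof -
  have "set_pmf (graph_step \<alpha> \<delta> t g) \<subseteq> (\<lambda>S. join_new (t + 3) S g) ` Pow (verts g)"
    by (auto elim!: set_graph_step simp: attachment_step_def)
  then show ?thesis using graph(2) by (meson finite_Pow_iff finite_imageI finite_subset)
qed

lemma expectation_graph_step:
  fixes f :: "ugraph \<Rightarrow> real"
  shows "measure_pmf.expectation (graph_step \<alpha> \<delta> t g) f =
    \<alpha> * ((\<Sum>e\<in>edges g. f (join_new (t + 3) e g)) / card (edges g)) +
    (1 - \<alpha>) * ((\<Sum>u\<in>verts g. (real (deg g u) + \<delta>) * f (join_new (t + 3) {u} g)) / weight_sum)"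
proof -
  have fin: "finite (set_pmf (preferential_vertex \<delta> t g))"
    using set_preferential_vertex graph(2) by (rule finite_subset)
  have "measure_pmf.expectation (preferential_vertex \<delta> t g) (\<lambda>u. f (join_new (t + 3) {u} g)) =
      (\<Sum>u\<in>verts g. f (join_new (t + 3) {u} g) * pmf (preferential_vertex \<delta> t g) u)"
    using set_preferential_vertex graph(2) by (intro integral_measure_pmf_real) auto
  also have "\<dots> = (\<Sum>u\<in>verts g. (real (deg g u) + \<delta>) * f (join_new (t + 3) {u} g)) / weight_sum"
    unfolding sum_divide_distrib
    by (rule sum.cong) (simp_all add: pmf_preferential_vertex_attachment_graph)
  finally show ?thesis
    unfolding graph_step_def using fin \<alpha> graph(3,4)
    by (subst pmf_expectation_bind[of UNIV]) (auto simp: UNIV_bool integral_pmf_of_set)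
qed

lemma sum_weights: "(\<Sum>u\<in>verts g. real (deg g u) + \<delta>) = weight_sum"
proof -
  have "(\<Sum>u\<in>verts g. real (deg g u) * 1) = (\<Sum>e\<in>edges g. \<Sum>u\<in>e. 1)"
    by (rule sum_deg[OF g, symmetric])
  also have "\<dots> = 2 * real (card (edges g))" using graph(6) by simp
  finally show ?thesis using graph(1) by (simp add: sum.distrib algebra_simps)
qed

lemma weight_sum_ge: "(1 + \<delta>) * (real t + 2) \<le> weight_sum"
proof -
  have "real t + 1 \<le> real (card (edges g))" using graph(8) by linarith
  then show ?thesis by (simp add: algebra_simps)
qed

lemma weight_sum_pos: "0 < weight_sum"
  using weight_sum_ge mult_pos_pos[of "1 + \<delta>" "real t + 2"] \<delta> by linarith

lemma expectation_card_edges: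
  "measure_pmf.expectation (graph_step \<alpha> \<delta> t g) (\<lambda>h. real (card (edges h))) = real (card (edges g)) + 1 + \<alpha>"
proof -
  let ?m = "real (card (edges g))"
  have m: "0 < ?m" using graph(8) by simp
  have "(\<Sum>e\<in>edges g. real (card (edges (join_new (t + 3) e g)))) = (\<Sum>e\<in>edges g. ?m + 2)"
    by (rule sum.cong) (simp_all add: attachment_step.card_edges_join[OF attachment_step_edge] graph(6))
  then have edge: "(\<Sum>e\<in>edges g. real (card (edges (join_new (t + 3) e g)))) / ?m = ?m + 2"
    using m by simp
  have "(\<Sum>u\<in>verts g. (real (deg g u) + \<delta>) * real (card (edges (join_new (t + 3) {u} g)))) =
      (\<Sum>u\<in>verts g. (real (deg g u) + \<delta>) * (?m + 1))"
    by (rule sum.cong) (simp_all add: attachment_step.card_edges_join[OF attachment_step_vertex])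
  also have "\<dots> = weight_sum * (?m + 1)"
    by (simp only: sum_weights flip: sum_distrib_right)
  finally have vertex:
    "(\<Sum>u\<in>verts g. (real (deg g u) + \<delta>) * real (card (edges (join_new (t + 3) {u} g)))) / weight_sum = ?m + 1"
    using weight_sum_pos by simp
  show ?thesis
    unfolding expectation_graph_step edge vertex by (simp add: algebra_simps)
qed

text \<open>A uniform edge contains a given vertex with probability proportional to its degree, so by linearity
of expectation both kinds of step reduce to a weighted sum over the vertices. The indicators belong
to the new vertex, which has degree \<open>1\<close> or \<open>2\<close>.\<close>

lemma drift_num_deg:
  "measure_pmf.expectation (graph_step \<alpha> \<delta> t g) (\<lambda>h. real (num_deg (Suc k) h)) - real (num_deg (Suc k) g) =
   (1 - \<alpha>) * (of_bool (k = 0) + ((real k + \<delta>) * num_deg k g - (real (Suc k) + \<delta>) * num_deg (Suc k) g) / weight_sum) +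
   \<alpha> * (of_bool (k = 1) + (real k * num_deg k g - real (Suc k) * num_deg (Suc k) g) / card (edges g))"
proof -
  let ?m = "real (card (edges g))" and ?N = "\<lambda>h. real (num_deg (Suc k) h)"
  define \<phi> :: "nat \<Rightarrow> real" where "\<phi> u = of_bool (Suc (deg g u) = Suc k) - of_bool (deg g u = Suc k)" for u
  have m: "0 < ?m" using graph(8) by simp
  have "(\<Sum>e\<in>edges g. ?N (join_new (t + 3) e g)) = (\<Sum>e\<in>edges g. ?N g + of_bool (k = 1) + (\<Sum>u\<in>e. \<phi> u))"
    by (rule sum.cong) (auto simp: attachment_step.num_deg_join[OF attachment_step_edge] graph(6) \<phi>_def)
  also have "\<dots> = ?m * (?N g + of_bool (k = 1)) + (\<Sum>u\<in>verts g. (real (deg g u) + 0) * \<phi> u)"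
    by (simp add: sum.distrib sum_deg[OF g])
  finally have edge: "(\<Sum>e\<in>edges g. ?N (join_new (t + 3) e g)) / ?m = ?N g + (of_bool (k = 1) +
      (real k * num_deg k g - real (Suc k) * num_deg (Suc k) g) / ?m)"
    unfolding \<phi>_def sum_deg_transitions[OF graph(2)] using m by (simp add: field_simps)
  have "(\<Sum>u\<in>verts g. (real (deg g u) + \<delta>) * ?N (join_new (t + 3) {u} g)) =
      (\<Sum>u\<in>verts g. (real (deg g u) + \<delta>) * (?N g + of_bool (k = 0)) + (real (deg g u) + \<delta>) * \<phi> u)"
    by (rule sum.cong)
       (auto simp: attachment_step.num_deg_join[OF attachment_step_vertex] \<phi>_def algebra_simps)
  also have "\<dots> = weight_sum * (?N g + of_bool (k = 0)) + (\<Sum>u\<in>verts g. (real (deg g u) + \<delta>) * \<phi> u)"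
    by (subst sum.distrib) (simp only: sum_weights flip: sum_distrib_right)
  finally have vertex: "(\<Sum>u\<in>verts g. (real (deg g u) + \<delta>) * ?N (join_new (t + 3) {u} g)) / weight_sum =
      ?N g + (of_bool (k = 0) + ((real k + \<delta>) * num_deg k g - (real (Suc k) + \<delta>) * num_deg (Suc k) g) / weight_sum)"
    unfolding \<phi>_def sum_deg_transitions[OF graph(2)] using weight_sum_pos
    by (simp only: add_divide_distrib) simp
  show ?thesis
    unfolding expectation_graph_step edge vertex by (simp add: algebra_simps)
qed

end

lemma num_deg_le:
  assumes "attachment_graph t g"
  shows "real (num_deg l g) \<le> real (t + 2)"
proof -
  have "num_deg l g \<le> card (verts g)"
    unfolding num_deg_def using attachment_graphD(2)[OF assms] by (intro card_mono) auto
  then show ?thesis using attachment_graphD(1)[OF assms] by simp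
qed

lemma num_deg_zero:
  assumes "attachment_graph t g"
  shows "num_deg 0 g = 0"
proof -
  have "{u \<in> verts g. deg g u = 0} = {}" using attachment_graphD(7)[OF assms] by fastforce
  then show ?thesis unfolding num_deg_def by (simp only: card.empty)
qed

section \<open>Deviations of the degree and edge counts\<close>

text \<open>Deviations are measured against multiples of the number \<open>t + 2\<close> of vertices and not of \<open>t\<close>, which
makes the linearized drift homogeneous, without further correction terms.\<close>

definition degree_deviation :: "real \<Rightarrow> real \<Rightarrow> nat \<Rightarrow> nat \<Rightarrow> ugraph \<Rightarrow> real" where
  "degree_deviation \<alpha> \<delta> l t g = real (num_deg l g) - p_lim \<alpha> \<delta> l * real (t + 2)"

definition edge_deviation :: "real \<Rightarrow> nat \<Rightarrow> ugraph \<Rightarrow> real" where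
  "edge_deviation \<alpha> t g = real (card (edges g)) - (1 + \<alpha>) * real (t + 2)"

text \<open>The summand \<open>1 / (1 + \<delta>)\<close> comes from the preferential choice, whose total weight is at least
\<open>(1 + \<delta>) n\<close>; the summand \<open>1\<close> comes from the choice of a uniform edge.\<close>

definition linearization_const :: "real \<Rightarrow> nat \<Rightarrow> real" where
  "linearization_const \<delta> k = 4 * (real (Suc k) + \<bar>\<delta>\<bar>) * (1 / (1 + \<delta>) + 1)"

lemma reciprocal_diff_bound:
  fixes x y :: real
  assumes "0 < a" "a \<le> x" "0 < b" "b \<le> y"
  shows "\<bar>1 / x - 1 / y\<bar> \<le> \<bar>y - x\<bar> / (a * b)"
proof -
  have "1 / x - 1 / y = (y - x) / (x * y)" using assms by (simp add: field_simps)
  then have "\<bar>1 / x - 1 / y\<bar> = \<bar>y - x\<bar> / (x * y)" using assms by (simp add: abs_mult)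
  also have "\<dots> \<le> \<bar>y - x\<bar> / (a * b)" using assms by (intro divide_left_mono mult_mono) auto
  finally show ?thesis .
qed

section \<open>The limiting degree frequencies\<close>

text \<open>The limit of \<open>n\<close> times the probability that a given vertex of degree \<open>l\<close> receives an edge when
there are \<open>n\<close> vertices. It equals \<open>l A\<^sub>l\<close> for \<open>l \<ge> 1\<close>; this form separates the two kinds of step.\<close>

definition attach_rate :: "real \<Rightarrow> real \<Rightarrow> nat \<Rightarrow> real" where
  "attach_rate \<alpha> \<delta> l = (1 - \<alpha>) * (real l + \<delta>) / (2 * (1 + \<alpha>) + \<delta>) + \<alpha> * real l / (1 + \<alpha>)"

text \<open>A value that comes from division by zero. It is the true frequency, as there are no isolated
vertices, and so the balance equation and the induction on the degree can start at \<open>0\<close>.\<close>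

lemma p_lim_zero: "p_lim \<alpha> \<delta> 0 = 0"
  by (simp add: p_lim_def)

context
  fixes \<alpha> \<delta> :: real
  assumes \<alpha>: "0 \<le> \<alpha>" "\<alpha> \<le> 1" and \<delta>: "-1 < \<delta>"
begin

lemma attach_rate_eq_A_seq:
  assumes "1 \<le> l"
  shows "attach_rate \<alpha> \<delta> l = real l * A_seq \<alpha> \<delta> l"
proof -
  have "real l \<noteq> 0" "1 + \<alpha> \<noteq> 0" "2 * (1 + \<alpha>) + \<delta> \<noteq> 0" using assms \<alpha> \<delta> by auto
  moreover from this have "\<alpha> + 1 \<noteq> 0" "2 * (\<alpha> + 1) + \<delta> \<noteq> 0" by (simp_all add: algebra_simps)
  ultimately show ?thesis
    by (simp add: attach_rate_def A_seq_def divide_simps) (simp add: algebra_simps power2_eq_square)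
qed

lemma attach_rate_affine:
  "attach_rate \<alpha> \<delta> l = A_lim \<alpha> \<delta> * real l + (1 - \<alpha>) * \<delta> / (2 * (1 + \<alpha>) + \<delta>)"
proof -
  have "1 + \<alpha> \<noteq> 0" "2 * (1 + \<alpha>) + \<delta> \<noteq> 0" using \<alpha> \<delta> by auto
  moreover from this have "\<alpha> + 1 \<noteq> 0" "2 * (\<alpha> + 1) + \<delta> \<noteq> 0" by (simp_all add: algebra_simps)
  ultimately show ?thesis
    by (simp add: attach_rate_def A_lim_def divide_simps) (simp add: algebra_simps power2_eq_square)
qed

lemma attach_rate_pos:
  assumes "1 \<le> l"
  shows "0 < attach_rate \<alpha> \<delta> l"
proof (cases "\<alpha> = 1")
  case False
  have "0 < real l + \<delta>" using assms \<delta> by simp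
  then have "0 < (1 - \<alpha>) * (real l + \<delta>) / (2 * (1 + \<alpha>) + \<delta>)"
    using False \<alpha> \<delta> by simp
  moreover have "0 \<le> \<alpha> * real l / (1 + \<alpha>)" using \<alpha> by simp
  ultimately show ?thesis unfolding attach_rate_def by linarith
qed (use assms in \<open>simp add: attach_rate_def\<close>)

lemma A_lim_pos: "0 < A_lim \<alpha> \<delta>"
proof -
  have "0 < \<alpha> * \<alpha> + \<alpha> + 1 + \<alpha> * (1 + \<delta>)"
    using \<alpha> \<delta> by (intro add_nonneg_pos add_pos_nonneg) auto
  also have "\<dots> = (\<alpha> + 1)\<^sup>2 + \<delta> * \<alpha>" by (simp add: power2_eq_square algebra_simps)
  finally show ?thesis unfolding A_lim_def using \<alpha> \<delta> by simp
qed

text \<open>The case \<open>l = 2\<close> in the definition agrees with the formula for larger \<open>l\<close>.\<close>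

lemma p_lim_eq_quotient:
  assumes "2 \<le> l"
  shows "p_lim \<alpha> \<delta> l = (attach_rate \<alpha> \<delta> 1 + \<alpha>) /
    (attach_rate \<alpha> \<delta> 1 * attach_rate \<alpha> \<delta> l * (\<Prod>j=1..l. 1 + 1 / attach_rate \<alpha> \<delta> j))"
proof -
  have prod: "(\<Prod>j=1..l. 1 + 1 / (real j * A_seq \<alpha> \<delta> j)) = (\<Prod>j=1..l. 1 + 1 / attach_rate \<alpha> \<delta> j)" for l
    by (rule prod.cong) (simp_all add: attach_rate_eq_A_seq)
  have rate1: "A_seq \<alpha> \<delta> 1 = attach_rate \<alpha> \<delta> 1" using attach_rate_eq_A_seq[of 1] by simp
  show ?thesis
  proof (cases "l = 2")
    case True
    define x where "x = attach_rate \<alpha> \<delta> 1"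
    define y where "y = attach_rate \<alpha> \<delta> 2"
    have "0 < x" "0 < y" by (simp_all add: x_def y_def attach_rate_pos)
    then have "x * y * ((1 + 1 / x) * (1 + 1 / y)) = (x + 1) * (y + 1)"
      by (simp add: field_simps)
    moreover have "(\<Prod>j=1..2. 1 + 1 / attach_rate \<alpha> \<delta> j) = (1 + 1 / x) * (1 + 1 / y)"
      by (simp add: x_def y_def numeral_2_eq_2)
    moreover have "2 * A_seq \<alpha> \<delta> 2 = y" using attach_rate_eq_A_seq[of 2] by (simp add: y_def)
    ultimately show ?thesis
      using True unfolding p_lim_def rate1 by (simp add: x_def y_def)
  next
    case False
    then show ?thesis
      using assms unfolding p_lim_def prod rate1 by (simp add: attach_rate_eq_A_seq)
  qed
qed

text \<open>The stationarity equation: in one step the expected number of vertices of degree \<open>Suc k\<close> has to grow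
by \<open>p_lim\<close> of that degree, which is the contribution of the new vertex plus the flow from degree \<open>k\<close>
minus the flow to the next degree.\<close>

lemma p_lim_balance:
  "p_lim \<alpha> \<delta> (Suc k) = (1 - \<alpha>) * of_bool (k = 0) + \<alpha> * of_bool (k = 1) +
     (attach_rate \<alpha> \<delta> k * p_lim \<alpha> \<delta> k - attach_rate \<alpha> \<delta> (Suc k) * p_lim \<alpha> \<delta> (Suc k))"
proof -
  let ?a = "attach_rate \<alpha> \<delta>"
  have pos: "0 < ?a (Suc j)" for j by (rule attach_rate_pos) simp
  have p1: "p_lim \<alpha> \<delta> (Suc 0) = (1 - \<alpha>) / (?a (Suc 0) + 1)"
    using attach_rate_eq_A_seq[of 1] by (simp add: p_lim_def)
  have ne: "?a (Suc j) + 1 \<noteq> 0" for j using pos[of j] by linarith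
  consider "k = 0" | "k = 1" | "2 \<le> k" by linarith
  then show ?thesis
  proof cases
    case 1
    then show ?thesis using ne[of 0] by (simp add: p1 p_lim_zero) (simp add: field_simps)
  next
    case 2
    have "p_lim \<alpha> \<delta> 2 = (?a 1 + \<alpha>) / ((?a 1 + 1) * (?a 2 + 1))"
      using attach_rate_eq_A_seq[of 1] attach_rate_eq_A_seq[of 2] by (simp add: p_lim_def)
    then have "p_lim \<alpha> \<delta> (Suc k) * (1 + ?a (Suc k)) = \<alpha> + ?a k * p_lim \<alpha> \<delta> k"
      using ne[of 0] ne[of 1] 2 by (simp add: p1 numeral_2_eq_2 divide_simps) (simp add: algebra_simps)
    then show ?thesis using 2 by (simp add: algebra_simps)
  next
    case 3
    define P where "P = (\<Prod>j=1..k. 1 + 1 / ?a j)"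
    have "0 < P" unfolding P_def by (rule prod_pos) (auto intro!: add_pos_pos attach_rate_pos)
    moreover have "0 < ?a k" using 3 by (intro attach_rate_pos) simp
    moreover have "p_lim \<alpha> \<delta> k = (?a 1 + \<alpha>) / (?a 1 * ?a k * P)"
      using p_lim_eq_quotient[OF 3] by (simp add: P_def)
    moreover have "p_lim \<alpha> \<delta> (Suc k) = (?a 1 + \<alpha>) / (?a 1 * ?a (Suc k) * (P * (1 + 1 / ?a (Suc k))))"
      using p_lim_eq_quotient[of "Suc k"] 3 by (simp add: P_def)
    moreover have "?a (Suc k) * (P * (1 + 1 / ?a (Suc k))) = P * (1 + ?a (Suc k))"
      using pos[of k] by (simp add: field_simps)
    ultimately have
      "p_lim \<alpha> \<delta> (Suc k) * (1 + ?a (Suc k)) = (?a 1 + \<alpha>) / (?a 1 * P)"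
      "?a k * p_lim \<alpha> \<delta> k = (?a 1 + \<alpha>) / (?a 1 * P)"
      using pos[of k] by (simp_all add: mult.assoc)
    then have "p_lim \<alpha> \<delta> (Suc k) * (1 + ?a (Suc k)) = ?a k * p_lim \<alpha> \<delta> k" by simp
    then show ?thesis using 3 by (simp add: algebra_simps)
  qed
qed

section \<open>Convergence of the degree counts\<close>

text \<open>The exact drift has the random edge count in its denominators. Replacing it by \<open>(1 + \<alpha>) n\<close> costs at
most a multiple of the deviation of the edge count over \<open>n\<close>, because the numerators are \<open>O(n)\<close> and
the denominators are at least of order \<open>n\<close>. The constant terms cancel by the balance equation.\<close>

lemma drift_linearization:
  assumes g: "attachment_graph t g"
  shows "\<bar>measure_pmf.expectation (graph_step \<alpha> \<delta> t g) (degree_deviation \<alpha> \<delta> (Suc k) (Suc t))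
      - degree_deviation \<alpha> \<delta> (Suc k) t g
      - (attach_rate \<alpha> \<delta> k * degree_deviation \<alpha> \<delta> k t g
         - attach_rate \<alpha> \<delta> (Suc k) * degree_deviation \<alpha> \<delta> (Suc k) t g) / real (t + 2)\<bar>
    \<le> linearization_const \<delta> k * \<bar>edge_deviation \<alpha> t g\<bar> / real (t + 2)"
proof -
  define n where "n = real (t + 2)"
  define m where "m = real (card (edges g))"
  define W where "W = 2 * m + \<delta> * n"
  define \<kappa> where "\<kappa> = 2 * (1 + \<alpha>) + \<delta>"
  define Y where "Y = edge_deviation \<alpha> t g"
  define a where "a = attach_rate \<alpha> \<delta>"
  define p where "p = p_lim \<alpha> \<delta>"
  define N where "N l = real (num_deg l g)" for l
  \<comment> \<open>Net flow into degree \<open>Suc k\<close>: with \<open>\<delta>\<close> for the preferential choice, with \<open>0\<close> for the edge.\<close>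
  define F where "F c = (real k + c) * N k - (real (Suc k) + c) * N (Suc k)" for c
  have n: "2 \<le> n" by (simp add: n_def)
  have m: "n / 2 \<le> m" using attachment_graphD(8)[OF g] by (simp add: n_def m_def)
  have N: "0 \<le> N l" "N l \<le> n" for l using num_deg_le[OF g] by (simp_all add: N_def n_def)
  have \<kappa>: "1 \<le> \<kappa>" using \<alpha> \<delta> by (simp add: \<kappa>_def)
  have W: "(1 + \<delta>) * n \<le> W"
    using weight_sum_ge[OF \<alpha> \<delta> g] by (simp add: W_def m_def n_def add.commute)
  have Y: "m = (1 + \<alpha>) * n + Y" by (simp add: Y_def edge_deviation_def m_def n_def)
  have int: "integrable (measure_pmf (graph_step \<alpha> \<delta> t g)) f" for f :: "ugraph \<Rightarrow> real"
    by (rule integrable_measure_pmf_finite[OF finite_graph_step[OF \<alpha> \<delta> g]])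
  define D where "D = measure_pmf.expectation (graph_step \<alpha> \<delta> t g) (degree_deviation \<alpha> \<delta> (Suc k) (Suc t))
      - degree_deviation \<alpha> \<delta> (Suc k) t g"
  have "D = measure_pmf.expectation (graph_step \<alpha> \<delta> t g) (\<lambda>h. real (num_deg (Suc k) h)) - N (Suc k) - p (Suc k)"
    unfolding D_def degree_deviation_def[abs_def] by (simp add: int N_def p_def algebra_simps)
  also have "\<dots> = (1 - \<alpha>) * (of_bool (k = 0) + F \<delta> / W) + \<alpha> * (of_bool (k = 1) + F 0 / m) - p (Suc k)"
    unfolding N_def drift_num_deg[OF \<alpha> \<delta> g] F_def W_def m_def n_def by simp
  finally have D: "D = (1 - \<alpha>) * (F \<delta> / W) + \<alpha> * (F 0 / m) - (a k * p k - a (Suc k) * p (Suc k))"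
    using p_lim_balance[of k] by (simp add: a_def p_def algebra_simps)
  have "a l = (1 - \<alpha>) / \<kappa> * (real l + \<delta>) + \<alpha> / (1 + \<alpha>) * real l" for l
    by (simp add: a_def attach_rate_def \<kappa>_def)
  then have "a k * N k - a (Suc k) * N (Suc k) = (1 - \<alpha>) / \<kappa> * F \<delta> + \<alpha> / (1 + \<alpha>) * F 0"
    unfolding F_def by (simp only:) (simp only: algebra_simps)
  then have "(a k * N k - a (Suc k) * N (Suc k)) / n =
      (1 - \<alpha>) * (F \<delta> / (\<kappa> * n)) + \<alpha> * (F 0 / ((1 + \<alpha>) * n))"
    by (simp add: add_divide_distrib)
  moreover have "(a k * degree_deviation \<alpha> \<delta> k t g - a (Suc k) * degree_deviation \<alpha> \<delta> (Suc k) t g) / n =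
      (a k * N k - a (Suc k) * N (Suc k)) / n - (a k * p k - a (Suc k) * p (Suc k))"
  proof -
    have "degree_deviation \<alpha> \<delta> l t g = N l - p l * n" for l
      by (simp add: degree_deviation_def N_def p_def n_def)
    then show ?thesis using n by (simp only:) (simp add: field_simps)
  qed
  ultimately have diff: "D - (a k * degree_deviation \<alpha> \<delta> k t g - a (Suc k) * degree_deviation \<alpha> \<delta> (Suc k) t g) / n =
      (1 - \<alpha>) * (F \<delta> * (1 / W - 1 / (\<kappa> * n))) + \<alpha> * (F 0 * (1 / m - 1 / ((1 + \<alpha>) * n)))"
    unfolding D by (simp add: algebra_simps)
  have F: "\<bar>F c\<bar> \<le> 2 * (real (Suc k) + \<bar>\<delta>\<bar>) * n" if c: "\<bar>c\<bar> \<le> \<bar>\<delta>\<bar>" for c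
  proof -
    have "\<bar>F c\<bar> \<le> \<bar>real k + c\<bar> * N k + \<bar>real (Suc k) + c\<bar> * N (Suc k)"
      unfolding F_def by (rule order_trans[OF abs_triangle_ineq4]) (simp add: abs_mult N)
    also have "\<dots> \<le> (real (Suc k) + \<bar>\<delta>\<bar>) * n + (real (Suc k) + \<bar>\<delta>\<bar>) * n"
      using c N n by (intro add_mono mult_mono) auto
    finally show ?thesis by (simp only: mult_2 distrib_right)
  qed
  have "\<bar>F \<delta> * (1 / W - 1 / (\<kappa> * n))\<bar> \<le>
      (2 * (real (Suc k) + \<bar>\<delta>\<bar>) * n) * (2 * \<bar>Y\<bar> / ((1 + \<delta>) * n * n))"
  proof -
    have "\<bar>1 / W - 1 / (\<kappa> * n)\<bar> \<le> \<bar>\<kappa> * n - W\<bar> / (((1 + \<delta>) * n) * n)"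
      using n W \<kappa> \<delta> by (intro reciprocal_diff_bound) auto
    also have "\<kappa> * n - W = - 2 * Y" by (simp add: W_def Y \<kappa>_def algebra_simps)
    finally show ?thesis
      unfolding abs_mult[of "F \<delta>"] using F[of \<delta>] n by (intro mult_mono) auto
  qed
  also have "\<dots> = 4 * (real (Suc k) + \<bar>\<delta>\<bar>) * (1 / (1 + \<delta>)) * \<bar>Y\<bar> / n"
    using n by simp
  also have "\<dots> \<le> linearization_const \<delta> k * \<bar>Y\<bar> / n"
    unfolding linearization_const_def using n \<delta>
    by (intro divide_right_mono mult_right_mono mult_left_mono) auto
  finally have vertex: "\<bar>F \<delta> * (1 / W - 1 / (\<kappa> * n))\<bar> \<le> linearization_const \<delta> k * \<bar>Y\<bar> / n" .
  have "\<bar>F 0 * (1 / m - 1 / ((1 + \<alpha>) * n))\<bar> \<le>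
      (2 * (real (Suc k) + \<bar>\<delta>\<bar>) * n) * (\<bar>Y\<bar> / (n / 2 * n))"
  proof -
    have "\<bar>1 / m - 1 / ((1 + \<alpha>) * n)\<bar> \<le> \<bar>(1 + \<alpha>) * n - m\<bar> / ((n / 2) * n)"
      using n m \<alpha> by (intro reciprocal_diff_bound) auto
    also have "(1 + \<alpha>) * n - m = - Y" by (simp add: Y)
    finally show ?thesis
      unfolding abs_mult[of "F 0"] using F[of 0] n by (intro mult_mono) auto
  qed
  also have "\<dots> = 4 * (real (Suc k) + \<bar>\<delta>\<bar>) * 1 * \<bar>Y\<bar> / n"
    using n by simp
  also have "\<dots> \<le> linearization_const \<delta> k * \<bar>Y\<bar> / n"
    unfolding linearization_const_def using n \<delta>
    by (intro divide_right_mono mult_right_mono mult_left_mono) auto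
  finally have edge: "\<bar>F 0 * (1 / m - 1 / ((1 + \<alpha>) * n))\<bar> \<le> linearization_const \<delta> k * \<bar>Y\<bar> / n" .
  have "\<bar>(1 - \<alpha>) * (F \<delta> * (1 / W - 1 / (\<kappa> * n))) + \<alpha> * (F 0 * (1 / m - 1 / ((1 + \<alpha>) * n)))\<bar> \<le>
      (1 - \<alpha>) * (linearization_const \<delta> k * \<bar>Y\<bar> / n) + \<alpha> * (linearization_const \<delta> k * \<bar>Y\<bar> / n)"
    using \<alpha> mult_left_mono[OF vertex, of "1 - \<alpha>"] mult_left_mono[OF edge, of \<alpha>]
    by (intro order_trans[OF abs_triangle_ineq] add_mono) (simp_all add: abs_mult)
  also have "\<dots> = linearization_const \<delta> k * \<bar>Y\<bar> / n"
    by (simp only: distrib_right[symmetric]) simp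
  finally show ?thesis
    unfolding diff[symmetric] unfolding D_def n_def Y_def a_def .
qed

lemma process_attachment_graph:
  "g \<in> set_pmf (chain_law initial_graph (graph_step \<alpha> \<delta>) t) \<Longrightarrow> attachment_graph t g"
proof (induction t arbitrary: g)
  case 0
  then show ?case using attachment_graph_initial by simp
next
  case (Suc t)
  then obtain g' where g': "attachment_graph t g'" and g: "g \<in> set_pmf (graph_step \<alpha> \<delta> t g')" by auto
  from set_graph_step[OF \<alpha> \<delta> g' g] obtain S where
    "attachment_step t g' S" "g = join_new (t + 3) S g'" .
  then show ?case by (simp only: attachment_step.attachment_graph_join)
qed

lemma finite_process: "finite (set_pmf (chain_law initial_graph (graph_step \<alpha> \<delta>) t))"
proof (induction t)
  case (Suc t)
  have "finite (set_pmf (graph_step \<alpha> \<delta> t g))"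
    if "g \<in> set_pmf (chain_law initial_graph (graph_step \<alpha> \<delta>) t)" for g
    by (rule finite_graph_step[OF \<alpha> \<delta> process_attachment_graph[OF that]])
  then show ?case using Suc by simp
qed simp

lemma mean_edge_deviation_negligible:
  "(\<lambda>t. measure_pmf.expectation (chain_law initial_graph (graph_step \<alpha> \<delta>) t) (\<lambda>g. \<bar>edge_deviation \<alpha> t g\<bar>)
     / real (t + 2)) \<longlonglongrightarrow> 0"
proof (rule mean_negligible_if_small_drift[where B = 2 and C = 2 and R = "\<lambda>_ _. 0"])
  fix t g assume "g \<in> set_pmf (chain_law initial_graph (graph_step \<alpha> \<delta>) t)"
  then have g: "attachment_graph t g" by (rule process_attachment_graph)
  have "0 \<le> real (card (edges g))" "real (card (edges g)) \<le> 2 * real t + 1"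
    using attachment_graphD(9)[OF g] by simp_all
  moreover have "0 \<le> (1 + \<alpha>) * real (t + 2)" "(1 + \<alpha>) * real (t + 2) \<le> 2 * real (t + 2)"
    using \<alpha> by (simp, intro mult_right_mono, simp_all)
  ultimately show "\<bar>edge_deviation \<alpha> t g\<bar> \<le> 2 * real (t + 2)"
    unfolding edge_deviation_def abs_le_iff by simp
  have "integrable (measure_pmf (graph_step \<alpha> \<delta> t g)) f" for f :: "ugraph \<Rightarrow> real"
    by (rule integrable_measure_pmf_finite[OF finite_graph_step[OF \<alpha> \<delta> g]])
  then have "measure_pmf.expectation (graph_step \<alpha> \<delta> t g) (edge_deviation \<alpha> (Suc t)) = edge_deviation \<alpha> t g"
    unfolding edge_deviation_def[abs_def] by (simp add: expectation_card_edges[OF \<alpha> \<delta> g] algebra_simps)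
  then show "edge_deviation \<alpha> t g * (measure_pmf.expectation (graph_step \<alpha> \<delta> t g) (edge_deviation \<alpha> (Suc t))
      - edge_deviation \<alpha> t g) \<le> \<bar>edge_deviation \<alpha> t g\<bar> * 0" by simp
  fix h assume "h \<in> set_pmf (graph_step \<alpha> \<delta> t g)"
  from set_graph_step[OF \<alpha> \<delta> g this] obtain S where
    S: "attachment_step t g S" and h: "h = join_new (t + 3) S g" .
  have "edge_deviation \<alpha> (Suc t) h - edge_deviation \<alpha> t g = real (card S) - (1 + \<alpha>)"
    using attachment_step.card_edges_join[OF S] by (simp add: edge_deviation_def h algebra_simps)
  then show "\<bar>edge_deviation \<alpha> (Suc t) h - edge_deviation \<alpha> t g\<bar> \<le> 2"
    using attachment_step.S(2)[OF S] \<alpha> by auto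
qed (simp_all add: finite_process)

text \<open>Induction on the degree: the deviation at degree \<open>l\<close> enters the drift at degree \<open>Suc l\<close> as an error
term that vanishes in mean.\<close>

lemma mean_degree_deviation_negligible:
  "(\<lambda>t. measure_pmf.expectation (chain_law initial_graph (graph_step \<alpha> \<delta>) t)
     (\<lambda>g. \<bar>degree_deviation \<alpha> \<delta> l t g\<bar>) / real (t + 2)) \<longlonglongrightarrow> 0"
proof (induction l)
  case 0
  have "measure_pmf.expectation (chain_law initial_graph (graph_step \<alpha> \<delta>) t) (\<lambda>g. \<bar>degree_deviation \<alpha> \<delta> 0 t g\<bar>)
      = measure_pmf.expectation (chain_law initial_graph (graph_step \<alpha> \<delta>) t) (\<lambda>_. 0)" for t
    using num_deg_zero[OF process_attachment_graph] p_lim_zero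
    by (intro integral_cong_AE AE_pmfI) (simp_all add: degree_deviation_def)
  then show ?case by simp
next
  case (Suc k)
  let ?P = "chain_law initial_graph (graph_step \<alpha> \<delta>)"
  let ?X = "degree_deviation \<alpha> \<delta>" and ?Y = "edge_deviation \<alpha>" and ?a = "attach_rate \<alpha> \<delta>"
  define c where "c = linearization_const \<delta> k"
  define p where "p = p_lim \<alpha> \<delta> (Suc k)"
  define R where "R t g = (\<bar>?a k\<bar> * \<bar>?X k t g\<bar> + c * \<bar>?Y t g\<bar>) / real (t + 2)" for t g
  have c: "0 \<le> c" using \<delta> by (simp add: c_def linearization_const_def)
  have int: "integrable (measure_pmf (?P t)) f" for t and f :: "ugraph \<Rightarrow> real"
    by (rule integrable_measure_pmf_finite[OF finite_process])
  show ?case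
  proof (rule mean_negligible_if_small_drift[where B = "1 + \<bar>p\<bar>" and C = "3 + \<bar>p\<bar>" and R = R])
    have "measure_pmf.expectation (?P t) (R t) =
        \<bar>?a k\<bar> * (measure_pmf.expectation (?P t) (\<lambda>g. \<bar>?X k t g\<bar>) / real (t + 2)) +
        c * (measure_pmf.expectation (?P t) (\<lambda>g. \<bar>?Y t g\<bar>) / real (t + 2))" for t
      unfolding R_def using int by (simp add: add_divide_distrib)
    then show "(\<lambda>t. measure_pmf.expectation (?P t) (R t)) \<longlonglongrightarrow> 0"
      using tendsto_add[OF tendsto_mult_left[OF Suc.IH, of "\<bar>?a k\<bar>"]
          tendsto_mult_left[OF mean_edge_deviation_negligible, of c]] by simp
  next
    fix t g assume "g \<in> set_pmf (?P t)"
    then have g: "attachment_graph t g" by (rule process_attachment_graph)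
    show "0 \<le> R t g" using c by (simp add: R_def)
    have "\<bar>?X (Suc k) t g\<bar> \<le> \<bar>real (num_deg (Suc k) g)\<bar> + \<bar>p * real (t + 2)\<bar>"
      unfolding degree_deviation_def p_def by (rule abs_triangle_ineq4)
    also have "\<dots> \<le> real (t + 2) + \<bar>p\<bar> * real (t + 2)"
      using num_deg_le[OF g, of "Suc k"] by (intro add_mono) (simp_all add: abs_mult)
    finally show "\<bar>?X (Suc k) t g\<bar> \<le> (1 + \<bar>p\<bar>) * real (t + 2)" by (simp add: algebra_simps)
    let ?D = "measure_pmf.expectation (graph_step \<alpha> \<delta> t g) (?X (Suc k) (Suc t)) - ?X (Suc k) t g"
    let ?x = "?X (Suc k) t g" and ?n = "real (t + 2)"
    define err where "err = ?D - (?a k * ?X k t g - ?a (Suc k) * ?x) / ?n"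
    have "\<bar>err\<bar> \<le> c * \<bar>?Y t g\<bar> / ?n"
      unfolding err_def c_def by (rule drift_linearization[OF g])
    then have small: "\<bar>?a k * ?X k t g / ?n + err\<bar> \<le> R t g"
      unfolding R_def add_divide_distrib by (intro order_trans[OF abs_triangle_ineq]) (simp add: abs_mult)
    have "?x * (?a k * ?X k t g / ?n + err) \<le> \<bar>?x\<bar> * R t g"
    proof -
      have "?x * (?a k * ?X k t g / ?n + err) \<le> \<bar>?x\<bar> * \<bar>?a k * ?X k t g / ?n + err\<bar>"
        unfolding abs_mult[symmetric] by (rule abs_ge_self)
      also have "\<dots> \<le> \<bar>?x\<bar> * R t g"
        using small by (intro mult_left_mono) simp_all
      finally show ?thesis .
    qed
    \<comment> \<open>The restoring part of the drift has the favourable sign and is dropped.\<close>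
    moreover have "0 \<le> ?a (Suc k) * ?x\<^sup>2 / ?n"
      using attach_rate_pos[of "Suc k"] by simp
    moreover have "?x * ?D = ?x * (?a k * ?X k t g / ?n + err) - ?a (Suc k) * ?x\<^sup>2 / ?n"
      unfolding err_def diff_divide_distrib by (simp add: algebra_simps power2_eq_square)
    ultimately show "?x * ?D \<le> \<bar>?x\<bar> * R t g" by linarith
    fix h assume "h \<in> set_pmf (graph_step \<alpha> \<delta> t g)"
    from set_graph_step[OF \<alpha> \<delta> g this] obtain S where
      S: "attachment_step t g S" and h: "h = join_new (t + 3) S g" .
    have "?X (Suc k) (Suc t) h - ?x = (real (num_deg (Suc k) h) - real (num_deg (Suc k) g)) - p"
      by (simp add: degree_deviation_def p_def algebra_simps)
    also have "\<bar>\<dots>\<bar> \<le> 3 + \<bar>p\<bar>"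
      using attachment_step.num_deg_join_diff[OF S, of "Suc k"] by (simp add: h)
    finally show "\<bar>?X (Suc k) (Suc t) h - ?x\<bar> \<le> 3 + \<bar>p\<bar>" .
  qed (rule finite_process)
qed

lemma prob_num_deg_near_p_lim:
  assumes \<epsilon>: "0 < \<epsilon>"
  shows "(\<lambda>t. measure_pmf.prob (chain_law initial_graph (graph_step \<alpha> \<delta>) t)
      {g. \<bar>real (num_deg l g) / real t - p_lim \<alpha> \<delta> l\<bar> < \<epsilon>}) \<longlonglongrightarrow> 1"
proof -
  let ?P = "chain_law initial_graph (graph_step \<alpha> \<delta>)"
  define p where "p = p_lim \<alpha> \<delta> l"
  define u where "u t g = \<bar>real (num_deg l g) / real t - p\<bar>" for t g
  define mean_dev where "mean_dev t = measure_pmf.expectation (?P t) (\<lambda>g. \<bar>degree_deviation \<alpha> \<delta> l t g\<bar>)" for t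
  have int: "integrable (measure_pmf (?P t)) f" for t and f :: "ugraph \<Rightarrow> real"
    by (rule integrable_measure_pmf_finite[OF finite_process])
  have lower: "1 - (mean_dev t / real (t + 2) * (1 + 2 / real t) + 2 * \<bar>p\<bar> / real t) / \<epsilon> \<le>
      measure_pmf.prob (?P t) {g. u t g < \<epsilon>}" if t: "1 \<le> t" for t
  proof -
    have "u t g \<le> \<bar>degree_deviation \<alpha> \<delta> l t g\<bar> / real t + 2 * \<bar>p\<bar> / real t" for g
    proof -
      have "real (num_deg l g) / real t - p = degree_deviation \<alpha> \<delta> l t g / real t + 2 * p / real t"
        using t by (simp add: degree_deviation_def p_def field_simps)
      then show ?thesis
        unfolding u_def using abs_triangle_ineq[of "degree_deviation \<alpha> \<delta> l t g / real t" "2 * p / real t"]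
        by (simp add: abs_mult)
    qed
    then have "measure_pmf.expectation (?P t) (u t) \<le>
        measure_pmf.expectation (?P t) (\<lambda>g. \<bar>degree_deviation \<alpha> \<delta> l t g\<bar> / real t + 2 * \<bar>p\<bar> / real t)"
      by (intro integral_mono int)
    also have "\<dots> = mean_dev t / real t + 2 * \<bar>p\<bar> / real t" by (simp add: int mean_dev_def)
    also have "mean_dev t / real t = mean_dev t / real (t + 2) * (1 + 2 / real t)"
    proof -
      have "1 + 2 / real t = real (t + 2) / real t" using t by (simp add: add_divide_distrib)
      then show ?thesis by simp
    qed
    finally have mean: "measure_pmf.expectation (?P t) (u t) \<le>
        mean_dev t / real (t + 2) * (1 + 2 / real t) + 2 * \<bar>p\<bar> / real t" .
    have "measure_pmf.prob (?P t) {g. \<epsilon> \<le> u t g} \<le> measure_pmf.expectation (?P t) (u t) / \<epsilon>"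
      using integral_Markov_inequality_measure[OF int, of "{}" t "u t" \<epsilon>] \<epsilon> by (simp add: u_def[abs_def])
    also have "\<dots> \<le> (mean_dev t / real (t + 2) * (1 + 2 / real t) + 2 * \<bar>p\<bar> / real t) / \<epsilon>"
      using mean \<epsilon> by (intro divide_right_mono) auto
    also have "{g. \<epsilon> \<le> u t g} = UNIV - {g. u t g < \<epsilon>}" by auto
    finally show ?thesis
      using measure_pmf.prob_compl[of "{g. u t g < \<epsilon>}" "?P t"] by simp
  qed
  have "(\<lambda>t. 1 + 2 / real t) \<longlonglongrightarrow> 1" "(\<lambda>t. 2 * \<bar>p\<bar> / real t) \<longlonglongrightarrow> 0" by real_asymp+
  then have "(\<lambda>t. 1 - (mean_dev t / real (t + 2) * (1 + 2 / real t) + 2 * \<bar>p\<bar> / real t) / \<epsilon>)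
      \<longlonglongrightarrow> 1 - (0 * 1 + 0) / \<epsilon>"
    using mean_degree_deviation_negligible[of l, folded mean_dev_def] \<epsilon> by (intro tendsto_intros) auto
  then have "(\<lambda>t. 1 - (mean_dev t / real (t + 2) * (1 + 2 / real t) + 2 * \<bar>p\<bar> / real t) / \<epsilon>) \<longlonglongrightarrow> 1"
    by simp
  then have "(\<lambda>t. measure_pmf.prob (?P t) {g. u t g < \<epsilon>}) \<longlonglongrightarrow> 1"
  proof (rule tendsto_sandwich[rotated 2])
    show "\<forall>\<^sub>F t in sequentially. 1 - (mean_dev t / real (t + 2) * (1 + 2 / real t) + 2 * \<bar>p\<bar> / real t) / \<epsilon> \<le>
        measure_pmf.prob (?P t) {g. u t g < \<epsilon>}"
      using lower eventually_ge_at_top[of 1] by (rule eventually_mono[rotated])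
    show "\<forall>\<^sub>F t in sequentially. measure_pmf.prob (?P t) {g. u t g < \<epsilon>} \<le> 1" by simp
  qed simp
  then show ?thesis by (simp add: u_def p_def)
qed

end

section \<open>The power law of the limiting frequencies\<close>

text \<open>With \<open>x = 1 + b / a\<close> the product is the quotient of the rising factorials of \<open>x + 1 / a\<close> and of \<open>x\<close>.
The limit formula for the Gamma function, applied to both, gives the limit
\<open>\<Gamma>(x) / \<Gamma>(x + 1 / a)\<close>. The argument \<open>x\<close> is positive because \<open>a + b\<close> is.\<close>

lemma prod_one_plus_reciprocal_asymp:
  fixes a b :: real
  assumes a: "0 < a" and ab: "0 < a + b"
  obtains L where "0 < L" "(\<lambda>n. (\<Prod>j=1..n. 1 + 1 / (a * real j + b)) / real n powr (1 / a)) \<longlonglongrightarrow> L"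
proof -
  define x where "x = 1 + b / a"
  define y where "y = x + 1 / a"
  have x: "0 < x" and y: "0 < y" using assms by (simp_all add: x_def y_def field_simps)
  have prod: "(\<Prod>j=1..n. 1 + 1 / (a * real j + b)) = pochhammer y n / pochhammer x n" for n
  proof -
    have "1 + 1 / (a * real (Suc j) + b) = (y + real j) / (x + real j)" for j
    proof -
      define z where "z = x + real j"
      have "0 < z" using x by (simp add: z_def)
      moreover have "a * real (Suc j) + b = a * z" using a by (simp add: z_def x_def field_simps)
      moreover have "y + real j = z + 1 / a" by (simp add: y_def z_def)
      ultimately show ?thesis using a unfolding z_def[symmetric] by (simp only:) (simp add: field_simps)
    qed
    then show ?thesis
      unfolding pochhammer_prod atLeast0LessThan prod_dividef[symmetric]
      by (simp add: prod.atLeast1_atMost_eq)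
  qed
  have "(\<lambda>n. Gamma_series' x n / Gamma_series' y n) \<longlonglongrightarrow> Gamma x / Gamma y"
    using y by (intro tendsto_divide Gamma_series'_LIMSEQ) (simp add: Gamma_real_pos less_imp_neq[symmetric])
  moreover have "\<forall>\<^sub>F n in sequentially. Gamma_series' x n / Gamma_series' y n =
      (\<Prod>j=1..n. 1 + 1 / (a * real j + b)) / real n powr (1 / a)"
    using eventually_gt_at_top[of 0]
  proof eventually_elim
    case (elim n)
    have "pochhammer x n \<noteq> 0" "pochhammer y n \<noteq> 0"
      using x y by (simp_all add: pochhammer_pos less_imp_neq[symmetric])
    moreover have "exp (y * ln (real n)) = exp (x * ln (real n)) * real n powr (1 / a)"
      using elim by (simp add: powr_def y_def algebra_simps flip: exp_add)
    ultimately show ?case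
      unfolding prod Gamma_series'_def by (simp add: field_simps)
  qed
  ultimately have "(\<lambda>n. (\<Prod>j=1..n. 1 + 1 / (a * real j + b)) / real n powr (1 / a)) \<longlonglongrightarrow> Gamma x / Gamma y"
    by (rule Lim_transform_eventually)
  moreover have "0 < Gamma x / Gamma y" using x y by (simp add: Gamma_real_pos)
  ultimately show ?thesis using that by blast
qed

text \<open>The hypotheses of the product asymptotics hold with \<open>a = A\<close> and with \<open>a + b\<close> equal to the attachment
rate of degree \<open>1\<close>, which is positive even when \<open>\<delta>\<close> is negative.\<close>

lemma p_lim_asymp:
  fixes \<alpha> \<delta> :: real
  assumes \<alpha>: "0 \<le> \<alpha>" "\<alpha> \<le> 1" and \<delta>: "-1 < \<delta>"
  obtains L where "0 < L" "(\<lambda>l. p_lim \<alpha> \<delta> l * real l powr (1 + 1 / A_lim \<alpha> \<delta>)) \<longlonglongrightarrow> L"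
proof -
  define a where "a = A_lim \<alpha> \<delta>"
  define b where "b = (1 - \<alpha>) * \<delta> / (2 * (1 + \<alpha>) + \<delta>)"
  define c where "c = (attach_rate \<alpha> \<delta> 1 + \<alpha>) / attach_rate \<alpha> \<delta> 1"
  define Q where "Q l = (\<Prod>j=1..l. 1 + 1 / (a * real j + b))" for l
  have rate: "attach_rate \<alpha> \<delta> l = a * real l + b" for l
    unfolding a_def b_def by (rule attach_rate_affine[OF \<alpha> \<delta>])
  have rate1: "0 < attach_rate \<alpha> \<delta> 1" by (rule attach_rate_pos[OF \<alpha> \<delta>]) simp
  then have ab: "0 < a + b" by (simp add: rate)
  have a: "0 < a" unfolding a_def by (rule A_lim_pos[OF \<alpha> \<delta>])
  have c: "0 < c" using rate1 \<alpha> by (simp add: c_def)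
  obtain L where L: "0 < L" "(\<lambda>n. Q n / real n powr (1 / a)) \<longlonglongrightarrow> L"
    unfolding Q_def by (rule prod_one_plus_reciprocal_asymp[OF a ab])
  have "(\<lambda>l. real l / (a * real l + b)) \<longlonglongrightarrow> inverse a"
    using a by real_asymp
  then have "(\<lambda>l. c * (real l / (a * real l + b)) / (Q l / real l powr (1 / a))) \<longlonglongrightarrow> c * inverse a / L"
    using L by (intro tendsto_intros) auto
  moreover have "\<forall>\<^sub>F l in sequentially. c * (real l / (a * real l + b)) / (Q l / real l powr (1 / a)) =
      p_lim \<alpha> \<delta> l * real l powr (1 + 1 / a)"
    using eventually_ge_at_top[of 2]
  proof eventually_elim
    case (elim l)
    have "p_lim \<alpha> \<delta> l = c / ((a * real l + b) * Q l)"
      unfolding p_lim_eq_quotient[OF \<alpha> \<delta> elim] c_def Q_def rate by (simp add: field_simps)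
    moreover have "real l powr (1 + 1 / a) = real l * real l powr (1 / a)"
      using elim by (simp add: powr_add)
    ultimately show ?case by (simp add: field_simps)
  qed
  ultimately have "(\<lambda>l. p_lim \<alpha> \<delta> l * real l powr (1 + 1 / a)) \<longlonglongrightarrow> c * inverse a / L"
    by (rule Lim_transform_eventually)
  moreover have "0 < c * inverse a / L" using a c L(1) by simp
  ultimately show ?thesis using that unfolding a_def by blast
qed

lemma theta_if_ratio_tendsto:
  fixes f :: "nat \<Rightarrow> real"
  assumes L: "0 < L" and lim: "(\<lambda>l. f l * real l powr \<gamma>) \<longlonglongrightarrow> L"
  shows "\<exists>c>0. \<exists>C>0. \<forall>\<^sub>F l in sequentially. c * real l powr - \<gamma> \<le> f l \<and> f l \<le> C * real l powr - \<gamma>"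
proof (intro exI conjI)
  show "0 < L / 2" "0 < 2 * L" using L by simp_all
  have "\<forall>\<^sub>F l in sequentially. L / 2 < f l * real l powr \<gamma>"
    by (rule order_tendstoD(1)[OF lim]) (use L in simp)
  moreover have "\<forall>\<^sub>F l in sequentially. f l * real l powr \<gamma> < 2 * L"
    by (rule order_tendstoD(2)[OF lim]) (use L in simp)
  ultimately show "\<forall>\<^sub>F l in sequentially. L / 2 * real l powr - \<gamma> \<le> f l \<and> f l \<le> 2 * L * real l powr - \<gamma>"
    using eventually_gt_at_top[of 0]
  proof eventually_elim
    case (elim l)
    then have "0 < real l powr \<gamma>" by simp
    then show ?case using elim by (simp add: powr_minus field_simps)
  qed
qed

section \<open>The degree distribution of the process\<close>

theorem theorem3p1:
  fixes \<alpha> \<delta> :: real and M :: "'w measure" and G :: "nat \<Rightarrow> 'w \<Rightarrow> ugraph"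
  assumes "0 \<le> \<alpha>" and "\<alpha> \<le> 1" and "-1 < \<delta>"
    and "random_graph_process \<alpha> \<delta> M G"
  shows "(\<forall>l\<ge>1. \<forall>\<epsilon>>0.
            (\<lambda>t. \<P>(\<omega> in M. \<bar>real (num_deg l (G t \<omega>)) / real t - p_lim \<alpha> \<delta> l\<bar> < \<epsilon>))
              \<longlonglongrightarrow> 1)
       \<and> (\<exists>c>0. \<exists>C>0. \<forall>\<^sub>F l in sequentially.
            c * real l powr - (1 + 1 / A_lim \<alpha> \<delta>) \<le> p_lim \<alpha> \<delta> l \<and>
            p_lim \<alpha> \<delta> l \<le> C * real l powr - (1 + 1 / A_lim \<alpha> \<delta>))"
proof (intro conjI allI impI)
  fix l :: nat and \<epsilon> :: real assume \<epsilon>: "0 < \<epsilon>"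
  interpret prob_space M using assms(4) by (simp add: random_graph_process_def)
  have "\<P>(\<omega> in M. G t \<omega> \<in> S) = measure_pmf.prob (chain_law initial_graph (graph_step \<alpha> \<delta>) t) S" for t S
    by (rule prob_eq_chain_law) (use assms(4) in \<open>auto simp: random_graph_process_def\<close>)
  from this[of _ "{g. \<bar>real (num_deg l g) / real _ - p_lim \<alpha> \<delta> l\<bar> < \<epsilon>}"]
  show "(\<lambda>t. \<P>(\<omega> in M. \<bar>real (num_deg l (G t \<omega>)) / real t - p_lim \<alpha> \<delta> l\<bar> < \<epsilon>)) \<longlonglongrightarrow> 1"
    using prob_num_deg_near_p_lim[OF assms(1-3) \<epsilon>, of l] by simp
next
  obtain L where "0 < L" "(\<lambda>l. p_lim \<alpha> \<delta> l * real l powr (1 + 1 / A_lim \<alpha> \<delta>)) \<longlonglongrightarrow> L"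
    by (rule p_lim_asymp[OF assms(1-3)])
  then show "\<exists>c>0. \<exists>C>0. \<forall>\<^sub>F l in sequentially.
      c * real l powr - (1 + 1 / A_lim \<alpha> \<delta>) \<le> p_lim \<alpha> \<delta> l \<and>
      p_lim \<alpha> \<delta> l \<le> C * real l powr - (1 + 1 / A_lim \<alpha> \<delta>)"
    by (rule theta_if_ratio_tendsto)
qed

end
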